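(* Let $d\ge 3$ and $2\le r\le d-1$ be fixed integers. The worst-case complexity of the Minkowski sum of $r$ $n$-vertex $d$-polytopes is in $\Theta\big(n^{\lfloor\frac{d+r-1}{2}\rfloor}\big)$. That is, if $g(n)$ denotes the maximum, over all $r$-tuples $(P_1,P_2,\ldots,P_r)$ of $d$-polytopes in $\mathbb{R}^d$ each having exactly $n$ vertices, of the total number of faces (of all dimensions) of $P_1+P_2+\cdots+P_r$, then $g(n)=\Theta\big(n^{\lfloor\frac{d+r-1}{2}\rfloor}\big)$ as $n\to\infty$, with implied constants depending only on $d$ and $r$.
   Context: A polytope is the convex hull of a finite set of points; a $d$-polytope is a polytope of dimension $d$. The Minkowski sum of sets is $A+B=\{a+b\mid a\in A, b\in B\}$. The complexity of a polytope is the total number of its faces of all dimensions. *)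

theory Defs
  imports "HOL-Analysis.Analysis" "HOL-Library.Landau_Symbols"
begin

text \<open>The relation \<^const>\<open>face_of\<close> admits the empty set and the polytope itself, so the whole face
  lattice is counted. Leaving out the empty face would only subtract 1.\<close>

definition complexity :: "'a::euclidean_space set \<Rightarrow> nat"
  where "complexity P = card {F. F face_of P}"

definition vertices :: "'a::euclidean_space set \<Rightarrow> 'a set"
  where "vertices P = {v. v extreme_point_of P}"

definition n_vertex_polytopes :: "nat \<Rightarrow> nat \<Rightarrow> 'a::euclidean_space set set"
  where "n_vertex_polytopes d n =
    {P. polytope P \<and> aff_dim P = int d \<and> finite (vertices P) \<and> card (vertices P) = n}"

text \<open>The sum of sets over an index set is the iterated Minkowski sum of \<^theory>\<open>HOL-Library.Set_Algebras\<close>;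
  only the values of \<open>P\<close> at the indices below \<open>r\<close> matter, so \<open>P\<close> encodes an \<open>r\<close>-tuple.
  The type argument fixes the ambient Euclidean space. The maximum is over a finite set, which is
  nonempty as soon as \<open>n > DIM('a) \<ge> 2\<close> (lemmas below); for \<open>n \<le> DIM('a)\<close> the value is irrelevant.\<close>

definition sum_complexities :: "'a::euclidean_space itself \<Rightarrow> nat \<Rightarrow> nat \<Rightarrow> nat set"
  where "sum_complexities _ r n =
    {complexity (\<Sum>i<r. P i) | P :: nat \<Rightarrow> 'a set. \<forall>i<r. P i \<in> n_vertex_polytopes DIM('a) n}"

definition max_sum_complexity :: "'a::euclidean_space itself \<Rightarrow> nat \<Rightarrow> nat \<Rightarrow> nat"
  where "max_sum_complexity T r n = Max (sum_complexities T r n)"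

lemma complexity_le_power:
  fixes V :: "'a::euclidean_space set"
  assumes "finite V"
  shows "complexity (convex hull V) \<le> 2 ^ card V"
proof -
  have "{F. F face_of convex hull V} \<subseteq> (\<lambda>W. convex hull W) ` Pow V"
    using face_of_convex_hull_subset[OF finite_imp_compact[OF assms]] by blast
  then have "complexity (convex hull V) \<le> card ((\<lambda>W. convex hull W) ` Pow V)"
    unfolding complexity_def by (intro card_mono) (use assms in auto)
  also have "\<dots> \<le> 2 ^ card V"
    using card_image_le[of "Pow V"] assms by (simp add: card_Pow)
  finally show ?thesis .
qed

lemma finite_card_set_sum_le:
  fixes W :: "nat \<Rightarrow> 'a::euclidean_space set"
  assumes "\<forall>i<r. finite (W i) \<and> card (W i) = n"
  shows "finite (\<Sum>i<r. W i) \<and> card (\<Sum>i<r. W i) \<le> n ^ r"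
  using assms
proof (induction r)
  case 0
  then show ?case by simp
next
  case (Suc r)
  let ?S = "\<Sum>i<r. W i"
  have IH: "finite ?S" "card ?S \<le> n ^ r" and W: "finite (W r)" "card (W r) = n"
    using Suc by auto
  have eq: "?S + W r = (\<lambda>(a, b). a + b) ` (?S \<times> W r)"
    by (auto simp: set_plus_def)
  have "card (?S + W r) \<le> card ?S * card (W r)"
    unfolding eq using card_image_le[of "?S \<times> W r"] IH W by (simp add: card_cartesian_product)
  also have "\<dots> \<le> n ^ r * n"
    using IH W by (intro mult_mono) auto
  finally have "card (?S + W r) \<le> n ^ Suc r"
    by (simp add: mult.commute)
  moreover have "finite (?S + W r)"
    unfolding eq using IH W by simp
  ultimately show ?case by simp
qed

lemma finite_sum_complexities: "finite (sum_complexities TYPE('a::euclidean_space) r n)"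
proof -
  have "complexity (\<Sum>i<r. P i) \<le> 2 ^ (n ^ r)"
    if P: "\<forall>i<r. P i \<in> n_vertex_polytopes DIM('a) n" for P :: "nat \<Rightarrow> 'a set"
  proof -
    have hull: "P i = convex hull (vertices (P i))" if "i < r" for i
      using P that Krein_Milman_Minkowski polytope_imp_compact polytope_imp_convex
      unfolding n_vertex_polytopes_def vertices_def by blast
    have V: "\<forall>i<r. finite (vertices (P i)) \<and> card (vertices (P i)) = n"
      using P unfolding n_vertex_polytopes_def by blast
    have "(\<Sum>i<r. P i) = (\<Sum>i<r. convex hull (vertices (P i)))"
      using hull by (intro sum.cong) auto
    also have "\<dots> = convex hull (\<Sum>i<r. vertices (P i))"
      by (simp add: convex_hull_set_sum)
    finally have "complexity (\<Sum>i<r. P i) \<le> 2 ^ card (\<Sum>i<r. vertices (P i))"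
      using complexity_le_power[of "\<Sum>i<r. vertices (P i)"] finite_card_set_sum_le[OF V] by simp
    also have "\<dots> \<le> 2 ^ (n ^ r)"
      using finite_card_set_sum_le[OF V] power_increasing[of _ "n ^ r" "2::nat"] by simp
    finally show ?thesis .
  qed
  then have "sum_complexities TYPE('a) r n \<subseteq> {..2 ^ (n ^ r)}"
    unfolding sum_complexities_def by blast
  then show ?thesis
    using finite_subset by blast
qed

lemma n_vertex_polytopes_nonempty:
  assumes "2 \<le> DIM('a::euclidean_space)" "DIM('a) < n"
  shows "(n_vertex_polytopes DIM('a) n :: 'a set set) \<noteq> {}"
proof -
  obtain b :: 'a where b: "b \<in> Basis"
    using nonempty_Basis by blast
  let ?B = "insert (- b) (Basis :: 'a set)"
  have infinite: "infinite (sphere (0::'a) 1)"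
  proof
    assume "finite (sphere (0::'a) 1)"
    then obtain a where "sphere (0::'a) 1 \<subseteq> {a}"
      using connected_sphere[of "0::'a" 1] assms connected_finite_iff_sing[of "sphere (0::'a) 1"]
      by auto
    moreover have "b \<in> sphere 0 1" "- b \<in> sphere 0 1"
      using b by auto
    ultimately have "b = - b" by blast
    then have "b \<bullet> b = (- b) \<bullet> b" by (rule arg_cong)
    then show False
      using b by simp
  qed
  have B: "?B \<subseteq> sphere 0 1" "finite ?B" "card ?B \<le> n"
    using b assms card_insert_le_m1[of n Basis "- b"] by (auto simp: card_insert_if)
  have "infinite (sphere (0::'a) 1 - ?B)"
    using infinite B by (simp add: infinite_super)
  then obtain C where C: "C \<subseteq> sphere 0 1 - ?B" "finite C" "card C = n - card ?B"
    using infinite_arbitrarily_large by metis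
  define V where "V = ?B \<union> C"
  have V: "finite V" "V \<subseteq> sphere 0 1" "?B \<subseteq> V"
    using B C unfolding V_def by auto
  have card: "card V = n"
    unfolding V_def using B C by (subst card_Un_disjoint) auto
  let ?P = "convex hull V"
  have sub: "?P \<subseteq> cball 0 1"
    using V by (intro hull_minimal) auto
  have "v extreme_point_of ?P" if "v \<in> V" for v
  proof -
    have "v \<notin> open_segment x y" if "x \<in> ?P" "y \<in> ?P" for x y
    proof
      assume v: "v \<in> open_segment x y"
      have "norm x \<le> 1" "norm y \<le> 1"
        using that sub by auto
      then have "dist 0 v < 1"
        using dist_decreases_open_segment[OF v, of 0] by (auto simp: dist_norm)
      then show False
        using \<open>v \<in> V\<close> V by auto
    qed
    then show ?thesis
      using that hull_inc[of v V] unfolding extreme_point_of_def by blast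
  qed
  then have vert: "vertices ?P = V"
    unfolding vertices_def using extreme_point_of_convex_hull by blast
  have "0 \<in> affine hull V"
  proof -
    have "(1/2) *\<^sub>R b + (1/2) *\<^sub>R (- b) \<in> affine hull V"
      using V b by (intro mem_affine[OF affine_affine_hull] hull_inc) auto
    then show ?thesis by simp
  qed
  then have "affine hull V = span V"
    using affine_hull_span_0 by blast
  moreover have "span V = UNIV"
    using V span_mono[of Basis V] by auto
  ultimately have "aff_dim ?P = int DIM('a)"
    by (metis aff_dim_UNIV aff_dim_affine_hull aff_dim_convex_hull)
  moreover have "polytope ?P"
    using V unfolding polytope_def by blast
  ultimately have "?P \<in> n_vertex_polytopes DIM('a) n"
    unfolding n_vertex_polytopes_def using vert V card by simp
  then show ?thesis by blast
qed

lemma sum_complexities_nonempty: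
  assumes "2 \<le> DIM('a::euclidean_space)" "DIM('a) < n"
  shows "sum_complexities TYPE('a) r n \<noteq> {}"
proof -
  obtain Q :: "'a set" where "Q \<in> n_vertex_polytopes DIM('a) n"
    using n_vertex_polytopes_nonempty[OF assms] by blast
  then have "complexity (\<Sum>i<r. Q) \<in> sum_complexities TYPE('a) r n"
    unfolding sum_complexities_def by (intro CollectI exI[of _ "\<lambda>_. Q"]) simp
  then show ?thesis by blast
qed

end

(* Nonempty faces of P_0 + ... + P_(r-1) correspond to the patterns of functionals u, where the
   pattern of u records which vertices of each P_i maximise u.

   Upper bound (the Cayley trick in dual form). After scaling u so that one coordinate is 1 or -1,
   patterns are tight sets of the system t_i >= u . v (v a vertex of P_i) in D = d + r - 1
   unknowns. Perturbing the right-hand side makes at most D constraints tight at any point, and each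
   original tight set is then recovered from a subset of the tight set of a vertex of the perturbed
   polyhedron, by linear programming duality. Seidel's argument bounds the number of vertices.

   Lower bound. Let K = D div 2 and k = K - r + 1. Take P_0 on the curve (t, t^2, ..., t^(2k)) and
   P_i, for 0 < i < r, on a parabola in the plane of the 2k-th coordinate and a coordinate of its own;
   2k + r - 1 <= d coordinates suffice. A functional built from the coefficients of
   -(prod_(s in S) (t - s))^2, and 2 s_i on the private coordinates, attains its maximum over P_0
   exactly at S and over P_i exactly at s_i, which gives (N choose k) * N^(r-1) faces. A far away simplex
   facet added to every P_i makes it full-dimensional without affecting these functionals. *)

theory Submission
  imports Defs "HOL-Computational_Algebra.Polynomial"
begin

section \<open>Tight sets of a system of linear inequalities\<close>

definition feasible :: "'j set \<Rightarrow> ('j \<Rightarrow> 'a::euclidean_space) \<Rightarrow> ('j \<Rightarrow> real) \<Rightarrow> 'a set"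
  where "feasible J a b = {y. \<forall>j\<in>J. b j \<le> a j \<bullet> y}"

definition tight :: "'j set \<Rightarrow> ('j \<Rightarrow> 'a::euclidean_space) \<Rightarrow> ('j \<Rightarrow> real) \<Rightarrow> 'a \<Rightarrow> 'j set"
  where "tight J a b y = {j \<in> J. a j \<bullet> y = b j}"

text \<open>These play the role of vertices. If the normals do not span the whole space, the
  polyhedron has no vertices; asking for \<open>y\<close> in the span of the normals picks one point
  from each minimal face.\<close>

definition basic_points :: "'j set \<Rightarrow> ('j \<Rightarrow> 'a::euclidean_space) \<Rightarrow> ('j \<Rightarrow> real) \<Rightarrow> 'a set"
  where "basic_points J a b =
    {y \<in> feasible J a b. y \<in> span (a ` J) \<and> span (a ` J) \<subseteq> span (a ` tight J a b y)}"

section \<open>Generic functionals and the number of basic points\<close>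

text \<open>Induction on the family: a point that avoids the earlier subspaces is pushed towards a
  vector outside the new one. Complements of subspaces are open, so a short push keeps the earlier
  ones avoided.\<close>

lemma subspace_not_covered:
  fixes U :: "'a::euclidean_space set"
  assumes "subspace U" "finite \<W>" "\<And>W. W \<in> \<W> \<Longrightarrow> subspace W \<and> \<not> U \<subseteq> W"
  obtains c where "c \<in> U" "\<And>W. W \<in> \<W> \<Longrightarrow> c \<notin> W"
proof -
  have "\<exists>c\<in>U. \<forall>W\<in>\<W>. c \<notin> W"
    using assms(2,3)
  proof (induction \<W> rule: finite_induct)
    case empty
    then show ?case
      using assms(1) subspace_0 by auto
  next
    case (insert W \<W>)
    then obtain c where c: "c \<in> U" "\<forall>W\<in>\<W>. c \<notin> W"
      by auto
    show ?case
    proof (cases "c \<in> W")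
      case False
      with c show ?thesis by auto
    next
      case True
      obtain w where w: "w \<in> U" "w \<notin> W"
        using insert.prems[of W] by auto
      have "((\<lambda>t. c + t *\<^sub>R w) \<longlongrightarrow> c) (at_right 0)"
        by (auto intro!: tendsto_eq_intros)
      then have "\<forall>\<^sub>F t in at_right 0. c + t *\<^sub>R w \<in> - W'" if "W' \<in> \<W>" for W'
        using that c insert.prems[of W'] closed_subspace
        by (intro topological_tendstoD) auto
      then have "\<forall>\<^sub>F t in at_right (0::real). \<forall>W'\<in>\<W>. c + t *\<^sub>R w \<notin> W'"
        using insert.hyps(1) by (simp add: eventually_ball_finite)
      then obtain t :: real where t: "t > 0" "\<forall>W'\<in>\<W>. c + t *\<^sub>R w \<notin> W'"
        using eventually_happens[OF eventually_conj[OF eventually_at_right_less[of 0]], of "\<lambda>t. \<forall>W'\<in>\<W>. c + t *\<^sub>R w \<notin> W'"]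
        by auto
      have W: "subspace W"
        using insert.prems by auto
      have "c + t *\<^sub>R w \<notin> W"
      proof
        assume "c + t *\<^sub>R w \<in> W"
        then have "(1/t) *\<^sub>R (c + t *\<^sub>R w - c) \<in> W"
          using W True subspace_diff subspace_scale by blast
        then show False
          using t w by simp
      qed
      moreover have "c + t *\<^sub>R w \<in> U"
        using c w assms(1) by (simp add: subspace_add subspace_scale)
      ultimately show ?thesis
        using t by auto
    qed
  qed
  then show ?thesis
    using that by blast
qed

lemma inner_span_cancel:
  assumes "U \<subseteq> span (a ` B)" "z \<in> U" "\<And>j. j \<in> B \<Longrightarrow> a j \<bullet> z = 0"
  shows "z = (0 :: 'a::euclidean_space)"
proof -
  have "orthogonal z w" if "w \<in> a ` B" for w
    using that assms(3) by (auto simp: orthogonal_def inner_commute)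
  then have "orthogonal z z"
    using assms(1,2) orthogonal_to_span by blast
  then show ?thesis
    by (simp add: orthogonal_self)
qed

text \<open>From \<open>y\<close> to \<open>y'\<close> the functional changes by the sum of
  \<open>\<nu> j * (a j \<bullet> y' - b j)\<close> over \<open>B\<close>. Terms with
  \<open>\<nu> j < 0\<close> vanish because those constraints are tight at \<open>y'\<close>, the
  others are nonnegative by feasibility. If the change is not positive, all terms vanish, and
  \<open>B\<close> spans enough to force \<open>y' = y\<close>.\<close>

lemma basic_point_minimizer:
  fixes a :: "'j \<Rightarrow> 'a::euclidean_space"
  assumes "finite B" "B \<subseteq> tight J a b y" and U: "span (a ` J) \<subseteq> span (a ` B)"
    and c: "c = (\<Sum>j\<in>B. \<nu> j *\<^sub>R a j)" and nz: "\<And>j. j \<in> B \<Longrightarrow> \<nu> j \<noteq> 0"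
    and y: "y \<in> span (a ` J)"
    and y': "y' \<in> span (a ` J)" "y' \<in> feasible J a b" "{j\<in>B. \<nu> j < 0} \<subseteq> tight J a b y'"
    and le: "c \<bullet> y' \<le> c \<bullet> y"
  shows "y' = y"
proof -
  have "c \<bullet> (y' - y) = (\<Sum>j\<in>B. \<nu> j * (a j \<bullet> y' - a j \<bullet> y))"
    by (simp add: c inner_sum_left inner_diff_right right_diff_distrib sum_subtractf)
  then have s: "(\<Sum>j\<in>B. \<nu> j * (a j \<bullet> y' - a j \<bullet> y)) \<le> 0"
    using le by (simp add: inner_diff_right)
  have nn: "0 \<le> \<nu> j * (a j \<bullet> y' - a j \<bullet> y)" if "j \<in> B" for j
  proof -
    have *: "j \<in> J" "a j \<bullet> y = b j"
      using that assms(2) by (auto simp: tight_def)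
    show ?thesis
    proof (cases "\<nu> j < 0")
      case True
      then have "a j \<bullet> y' = b j"
        using y'(3) that by (auto simp: tight_def)
      with * show ?thesis by simp
    next
      case False
      with * y'(2) show ?thesis
        by (simp add: feasible_def)
    qed
  qed
  have "a j \<bullet> (y' - y) = 0" if "j \<in> B" for j
  proof -
    have "\<nu> j * (a j \<bullet> y' - a j \<bullet> y) = 0"
      using sum_nonneg_eq_0_iff[OF assms(1), of "\<lambda>j. \<nu> j * (a j \<bullet> y' - a j \<bullet> y)"] nn that
        antisym[OF s sum_nonneg[OF nn]] by auto
    then show ?thesis
      using nz[OF that] by (simp add: inner_diff_right)
  qed
  then have "y' - y = 0"
    using y y'(1) U by (intro inner_span_cancel[of "span (a ` J)"]) (auto intro: span_diff)
  then show ?thesis by simp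
qed

text \<open>The idea is Seidel's proof of the asymptotic upper bound theorem: a vertex is the unique
  minimum or maximum of a fixed generic functional on one of its faces of dimension at least half
  that of the polyhedron. Stated with the inequalities, this needs no simplicity.\<close>

lemma card_basic_points:
  fixes a :: "'j \<Rightarrow> 'a::euclidean_space"
  assumes J: "finite J"
  shows "finite (basic_points J a b)"
    and "card (basic_points J a b) \<le> 2 * card {N. N \<subseteq> J \<and> card N \<le> dim (a ` J) div 2}"
proof -
  let ?U = "span (a ` J)" and ?D = "dim (a ` J)"
  \<comment> \<open>The functional \<open>c\<close> will avoid every span of a subset of the normals
    that does not contain \<open>?U\<close>. Its expansion in any basis of \<open>?U\<close> drawn
    from the normals then has no zero coefficient.\<close>
  let ?\<W> = "(\<lambda>B. span (a ` B)) ` {B \<in> Pow J. \<not> ?U \<subseteq> span (a ` B)}"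
  obtain c where c: "c \<in> ?U" "\<And>W. W \<in> ?\<W> \<Longrightarrow> c \<notin> W"
    by (rule subspace_not_covered[of ?U ?\<W>]) (use J in auto)
  \<comment> \<open>A key of \<open>y\<close> is a sign and a small set of constraints tight at
    \<open>y\<close>, such that \<open>y\<close> is the only minimum (\<open>True\<close>) or the
    only maximum (\<open>False\<close>) of \<open>c\<close> on the face where these constraints are
    tight.\<close>
  define key where "key y = (\<lambda>(s::bool, N).
     N \<subseteq> J \<and> card N \<le> ?D div 2 \<and> N \<subseteq> tight J a b y \<and>
     (\<forall>y'. y' \<in> ?U \<longrightarrow> y' \<in> feasible J a b \<longrightarrow> N \<subseteq> tight J a b y' \<longrightarrow>
        (if s then c \<bullet> y' \<le> c \<bullet> y else c \<bullet> y \<le> c \<bullet> y') \<longrightarrow> y' = y))" for y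
  have ex: "\<exists>k. key y k" if y: "y \<in> basic_points J a b" for y
  proof -
    let ?T = "tight J a b y"
    have yU: "y \<in> ?U" "?U \<subseteq> span (a ` ?T)" and TJ: "?T \<subseteq> J"
      using y by (auto simp: basic_points_def tight_def)
    obtain A where A: "A \<subseteq> a ` ?T" "independent A" "a ` ?T \<subseteq> span A"
      using maximal_independent_subset by blast
    obtain B where B: "B \<subseteq> ?T" "inj_on a B" "A = a ` B"
      using A(1) by (auto simp: subset_image_inj)
    have UB: "?U \<subseteq> span (a ` B)"
      using yU(2) A(3) B(3) span_minimal[of "a ` ?T" "span A"] by auto
    have fB: "finite B"
      using J by (rule finite_subset[rotated]) (use B(1) TJ in auto)
    have cardB: "card B \<le> ?D"
    proof -
      have "card B = card A"
        using B card_image by metis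
      also have "A \<subseteq> ?U"
        using A(1) TJ span_superset[of "a ` J"] by blast
      then have "card A \<le> ?D"
        using A(2) independent_card_le_dim[of A ?U] by simp
      finally show ?thesis .
    qed
    have "c \<in> span (a ` B)"
      using c(1) UB by blast
    then obtain \<mu> where "c = (\<Sum>w\<in>a ` B. \<mu> w *\<^sub>R w)"
      using fB by (auto simp: span_finite)
    then have cs: "c = (\<Sum>j\<in>B. \<mu> (a j) *\<^sub>R a j)"
      using B(2) by (simp add: sum.reindex)
    define \<nu> where "\<nu> j = \<mu> (a j)" for j
    have cs: "c = (\<Sum>j\<in>B. \<nu> j *\<^sub>R a j)"
      using cs by (simp add: \<nu>_def)
    have nz: "\<nu> j \<noteq> 0" if j: "j \<in> B" for j
    proof
      assume 0: "\<nu> j = 0"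
      have "c = (\<Sum>i\<in>B - {j}. \<nu> i *\<^sub>R a i)"
        using cs 0 j fB by (simp add: sum.remove)
      then have "c \<in> span (a ` (B - {j}))"
        by (simp only:) (intro span_sum span_scale span_base imageI)
      then have "?U \<subseteq> span (a ` (B - {j}))"
        using c(2)[of "span (a ` (B - {j}))"] B(1) TJ by blast
      moreover have "a j \<in> ?U"
        using j B(1) TJ by (auto intro: span_base)
      moreover have "a ` (B - {j}) = A - {a j}"
        using B(2,3) j by (auto simp: inj_on_def)
      ultimately show False
        using A(2) B(3) j by (auto simp: dependent_def)
    qed
    have BT: "finite B" "B \<subseteq> ?T" by (fact fB, fact B(1))
    \<comment> \<open>The nonzero coefficients split \<open>B\<close> by sign, and one half has at
      most \<open>?D div 2\<close> elements. \<open>?N\<close> makes \<open>y\<close> a minimum of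
      \<open>c\<close>, \<open>?P\<close> a minimum of \<open>- c\<close>.\<close>
    let ?N = "{j\<in>B. \<nu> j < 0}" and ?P = "{j\<in>B. - \<nu> j < 0}"
    have "card ?N + card ?P = card (?N \<union> ?P)"
      by (rule card_Un_disjoint[symmetric]) (use fB in auto)
    also have "\<dots> \<le> card B"
      by (rule card_mono) (use fB in auto)
    finally have le: "card ?N + card ?P \<le> ?D"
      using cardB by simp
    have cs': "- c = (\<Sum>j\<in>B. (- \<nu> j) *\<^sub>R a j)"
      by (simp add: cs sum_negf)
    show ?thesis
    proof (cases "card ?N \<le> ?D div 2")
      case True
      have "y' = y" if "y' \<in> ?U" "y' \<in> feasible J a b" "?N \<subseteq> tight J a b y'" "c \<bullet> y' \<le> c \<bullet> y" for y'
        by (rule basic_point_minimizer[OF BT UB cs nz yU(1) that(1-3)]) (use that in auto)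
      then have "key y (True, ?N)"
        unfolding key_def using True BT TJ by auto
      then show ?thesis ..
    next
      case False
      then have P: "card ?P \<le> ?D div 2"
        using le by linarith
      have "y' = y" if "y' \<in> ?U" "y' \<in> feasible J a b" "?P \<subseteq> tight J a b y'" "c \<bullet> y \<le> c \<bullet> y'" for y'
        by (rule basic_point_minimizer[OF BT UB cs' _ yU(1) that(1-3)]) (use nz that in auto)
      then have "key y (False, ?P)"
        unfolding key_def using P BT TJ by auto
      then show ?thesis ..
    qed
  qed
  define f where "f y = (SOME k. key y k)" for y
  have f: "key y (f y)" if "y \<in> basic_points J a b" for y
    unfolding f_def using ex[OF that] by (rule someI_ex)
  let ?K = "(UNIV :: bool set) \<times> {N. N \<subseteq> J \<and> card N \<le> ?D div 2}"
  have fin: "finite ?K"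
    using J by auto
  have inj: "inj_on f (basic_points J a b)"
  proof (rule inj_onI)
    fix x y
    assume xy: "x \<in> basic_points J a b" "y \<in> basic_points J a b" "f x = f y"
    obtain s N where sN: "f x = (s, N)"
      by fastforce
    have k: "key x (s, N)" "key y (s, N)"
      using f[OF xy(1)] f[OF xy(2)] xy(3) sN by simp_all
    have m: "x \<in> ?U" "x \<in> feasible J a b" "y \<in> ?U" "y \<in> feasible J a b"
      using xy by (auto simp: basic_points_def)
    have uniq: "v = u" if "key u (s, N)" "key v (s, N)" "v \<in> ?U" "v \<in> feasible J a b"
      "if s then c \<bullet> v \<le> c \<bullet> u else c \<bullet> u \<le> c \<bullet> v" for u v
      using that unfolding key_def prod.case by blast
    \<comment> \<open>Of two points with the same key, one has a value of \<open>c\<close> at least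
      as good as the other, whose uniqueness then identifies them.\<close>
    have "(if s then c \<bullet> x \<le> c \<bullet> y else c \<bullet> y \<le> c \<bullet> x) \<or>
      (if s then c \<bullet> y \<le> c \<bullet> x else c \<bullet> x \<le> c \<bullet> y)"
      by (cases s) auto
    then show "x = y"
      using uniq[OF k(2) k(1) m(1,2)] uniq[OF k m(3,4)] by metis
  qed
  have sub: "f ` basic_points J a b \<subseteq> ?K"
  proof (intro subsetI)
    fix k assume "k \<in> f ` basic_points J a b"
    then obtain y where "key y k"
      using f by auto
    then show "k \<in> ?K"
      by (cases k) (simp add: key_def)
  qed
  show "finite (basic_points J a b)"
    by (rule finite_imageD[OF finite_subset[OF sub fin] inj])
  have "card (basic_points J a b) \<le> card ?K"
    using card_inj_on_le[OF inj sub fin] .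
  then show "card (basic_points J a b) \<le> 2 * card {N. N \<subseteq> J \<and> card N \<le> ?D div 2}"
    by (simp add: card_cartesian_product)
qed

section \<open>Linear programming: optimal basic points and dual multipliers\<close>

text \<open>Among the feasible points at least as good as \<open>x\<close>, take one with the most
  tight constraints. If the tight normals did not span, one could move orthogonally to them without
  increasing \<open>c\<close> until a further constraint becomes tight. That \<open>c\<close> is
  nonnegative on the recession cone ensures that the move meets such a constraint.\<close>

lemma basic_point_below:
  fixes a :: "'j \<Rightarrow> 'a::euclidean_space"
  assumes J: "finite J" and x: "x \<in> feasible J a b"
    and c: "\<And>z. (\<And>j. j \<in> J \<Longrightarrow> 0 \<le> a j \<bullet> z) \<Longrightarrow> 0 \<le> c \<bullet> z" "c \<in> span (a ` J)"
  obtains v where "v \<in> basic_points J a b" "c \<bullet> v \<le> c \<bullet> x"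
proof -
  let ?U = "span (a ` J)" and ?T = "tight J a b"
  let ?good = "\<lambda>y. y \<in> feasible J a b \<and> c \<bullet> y \<le> c \<bullet> x"
  have bound: "\<forall>y. ?good y \<longrightarrow> card (?T y) \<le> card J"
    using J by (auto intro!: card_mono simp: tight_def)
  have "?good x"
    using x by simp
  then obtain y where y: "?good y" and max: "\<And>y'. ?good y' \<Longrightarrow> card (?T y') \<le> card (?T y)"
    using ex_has_greatest_nat[of ?good x "\<lambda>y. card (?T y)" "Suc (card J)"] bound by (auto simp: less_Suc_eq_le)
  have span: "?U \<subseteq> span (a ` ?T y)"
  proof (rule ccontr)
    assume "\<not> ?U \<subseteq> span (a ` ?T y)"
    moreover have "span (a ` ?T y) \<subseteq> ?U"
      by (intro span_mono image_mono) (auto simp: tight_def)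
    ultimately have "span (a ` ?T y) \<subset> ?U"
      by auto
    then obtain z where z: "z \<noteq> 0" "z \<in> ?U" "\<And>w. w \<in> span (a ` ?T y) \<Longrightarrow> orthogonal z w"
      by (rule orthogonal_to_subspace_exists_gen) blast
    have z0: "a j \<bullet> z = 0" if "j \<in> ?T y" for j
      using z(3)[of "a j"] that by (auto simp: orthogonal_def inner_commute intro: span_base)
    have "\<exists>z. (\<forall>j\<in>?T y. a j \<bullet> z = 0) \<and> c \<bullet> z \<le> 0 \<and> (\<exists>j\<in>J. a j \<bullet> z < 0)"
    proof -
      obtain j where j: "j \<in> J" "a j \<bullet> z \<noteq> 0"
        using inner_span_cancel[of ?U a J z] z by blast
      \<comment> \<open>Both \<open>z\<close> and \<open>- z\<close> keep the tight constraints
        tight. If one of them lowers \<open>c\<close>, it is not a recession direction, so some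
        constraint decreases; if \<open>c\<close> is constant along \<open>z\<close>, the sign is
        chosen to make constraint \<open>j\<close> decrease.\<close>
      consider "c \<bullet> z < 0" | "c \<bullet> (- z) < 0" | "c \<bullet> z = 0" "a j \<bullet> z < 0" | "c \<bullet> z = 0" "a j \<bullet> (- z) < 0"
        using j by fastforce
      then show ?thesis
      proof cases
        case 1
        then have "\<exists>j\<in>J. a j \<bullet> z < 0"
          using c(1)[of z] by force
        with 1 z0 show ?thesis
          by (intro exI[of _ z]) auto
      next
        case 2
        then have "\<exists>j\<in>J. a j \<bullet> (- z) < 0"
          using c(1)[of "- z"] by force
        with 2 z0 show ?thesis
          by (intro exI[of _ "- z"]) auto
      next
        case 3
        with z0 j show ?thesis
          by (intro exI[of _ z]) auto
      next
        case 4
        with z0 j show ?thesis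
          by (intro exI[of _ "- z"]) auto
      qed
    qed
    then obtain z where z: "\<And>j. j \<in> ?T y \<Longrightarrow> a j \<bullet> z = 0" "c \<bullet> z \<le> 0" "\<exists>j\<in>J. a j \<bullet> z < 0"
      by auto
    let ?N = "{j\<in>J. a j \<bullet> z < 0}"
    \<comment> \<open>Ratio test: \<open>\<eta> j\<close> is the step length at which constraint
      \<open>j\<close> becomes tight, and the smallest one is taken.\<close>
    define \<eta> where "\<eta> j = (a j \<bullet> y - b j) / (- (a j \<bullet> z))" for j
    obtain i where i: "i \<in> ?N" "\<And>j. j \<in> ?N \<Longrightarrow> \<eta> i \<le> \<eta> j"
      using ex_is_arg_min_if_finite[of ?N \<eta>] J z(3) by (auto simp: is_arg_min_linorder)
    have pos: "\<eta> i \<ge> 0"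
      using i(1) y by (auto simp: \<eta>_def feasible_def divide_simps)
    let ?y = "y + \<eta> i *\<^sub>R z"
    have "b j \<le> a j \<bullet> ?y" if j: "j \<in> J" for j
    proof (cases "a j \<bullet> z < 0")
      case True
      then have "\<eta> i \<le> (a j \<bullet> y - b j) / (- (a j \<bullet> z))"
        using i(2)[of j] j by (simp only: \<eta>_def[of j]) simp
      then have "\<eta> i * (- (a j \<bullet> z)) \<le> a j \<bullet> y - b j"
        using True by (subst (asm) pos_le_divide_eq) auto
      then show ?thesis
        by (simp add: inner_add_right)
    next
      case False
      moreover have "b j \<le> a j \<bullet> y"
        using y j by (auto simp: feasible_def)
      ultimately show ?thesis
        using pos by (simp add: inner_add_right add_increasing2)
    qed
    moreover have "c \<bullet> ?y \<le> c \<bullet> x"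
      using y z(2) pos mult_nonneg_nonpos[of "\<eta> i" "c \<bullet> z"] by (simp add: inner_add_right)
    ultimately have "?good ?y"
      by (simp add: feasible_def)
    moreover have "?T y \<subseteq> ?T ?y"
      using z(1) by (auto simp: tight_def inner_add_right)
    moreover have "i \<in> ?T ?y"
      using i(1) by (simp add: tight_def inner_add_right) (simp add: \<eta>_def)
    moreover have "i \<notin> ?T y"
      using i(1) z(1) by force
    moreover have "finite (?T ?y)"
      using J by (simp add: tight_def)
    ultimately have "card (?T y) < card (?T ?y)"
      by (intro psubset_card_mono) auto
    then show False
      using max[OF \<open>?good ?y\<close>] by simp
  qed
  \<comment> \<open>Dropping the component orthogonal to all normals changes neither the constraint
    values nor \<open>c\<close>.\<close>
  obtain v w where vw: "v \<in> ?U" "\<And>u. u \<in> ?U \<Longrightarrow> orthogonal w u" "y = v + w"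
    using orthogonal_subspace_decomp_exists[of "a ` J" y] by blast
  have inner: "a j \<bullet> v = a j \<bullet> y" if "j \<in> J" for j
    using vw(2)[of "a j"] that vw(3) by (simp add: inner_add_right orthogonal_def inner_commute span_base)
  have "c \<bullet> w = 0"
    using vw(2)[OF c(2)] by (simp add: orthogonal_def inner_commute)
  then have "c \<bullet> v \<le> c \<bullet> x"
    using y vw(3) by (simp add: inner_add_right)
  moreover have "?T v = ?T y"
    using inner by (auto simp: tight_def)
  then have "v \<in> basic_points J a b"
    using y span vw(1) inner by (auto simp: basic_points_def feasible_def)
  ultimately show ?thesis
    using that by blast
qed

lemma cone_hull_image_sum:
  assumes "x \<in> convex_cone hull (a ` W)" "finite W"
  shows "\<exists>\<nu>. (\<forall>j\<in>W. 0 \<le> \<nu> j) \<and> x = (\<Sum>j\<in>W. \<nu> j *\<^sub>R (a j :: 'a::euclidean_space))"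
proof -
  let ?C = "{x. \<exists>\<nu>. (\<forall>j\<in>W. 0 \<le> \<nu> j) \<and> x = (\<Sum>j\<in>W. \<nu> j *\<^sub>R a j)}"
  have "convex_cone ?C"
    unfolding convex_cone_iff
  proof (intro conjI ballI allI impI)
    show "0 \<in> ?C" by (auto intro!: exI[of _ "\<lambda>_. 0"])
  next
    fix x y assume "x \<in> ?C" "y \<in> ?C"
    then obtain \<nu> \<mu> where *: "\<forall>j\<in>W. 0 \<le> \<nu> j" "x = (\<Sum>j\<in>W. \<nu> j *\<^sub>R a j)"
      "\<forall>j\<in>W. 0 \<le> \<mu> j" "y = (\<Sum>j\<in>W. \<mu> j *\<^sub>R a j)" by auto
    then show "x + y \<in> ?C"
      by (auto intro!: exI[of _ "\<lambda>j. \<nu> j + \<mu> j"] simp: sum.distrib scaleR_left_distrib)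
  next
    fix x and t :: real assume "x \<in> ?C" "t \<ge> 0"
    then obtain \<nu> where "\<forall>j\<in>W. 0 \<le> \<nu> j" "x = (\<Sum>j\<in>W. \<nu> j *\<^sub>R a j)" by auto
    then show "t *\<^sub>R x \<in> ?C"
      using \<open>t \<ge> 0\<close> by (auto intro!: exI[of _ "\<lambda>j. t * \<nu> j"] simp: scaleR_sum_right)
  qed
  moreover have "a ` W \<subseteq> ?C"
  proof clarify
    fix j assume "j \<in> W"
    then have "a j = (\<Sum>i\<in>W. (if i = j then 1 else 0) *\<^sub>R a i)"
      using assms(2) by (simp add: if_distrib[of "\<lambda>t. t *\<^sub>R _"] cong: if_cong)
    then show "\<exists>\<nu>. (\<forall>j\<in>W. 0 \<le> \<nu> j) \<and> a j = (\<Sum>j\<in>W. \<nu> j *\<^sub>R a j)"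
      by (intro exI[of _ "\<lambda>i. if i = j then 1 else 0"]) auto
  qed
  ultimately have "convex_cone hull (a ` W) \<subseteq> ?C"
    by (intro hull_minimal)
  with assms(1) show ?thesis by auto
qed

text \<open>Farkas: if \<open>c\<close> were outside the closed cone generated by the tight normals,
  a separating vector \<open>z\<close> would satisfy \<open>c \<bullet> z < 0\<close> and
  \<open>0 \<le> a j \<bullet> z\<close> for all tight \<open>j\<close>. A short step from
  \<open>v\<close> along \<open>z\<close> would stay feasible and lower \<open>c\<close>.\<close>

lemma optimal_multipliers:
  fixes a :: "'j \<Rightarrow> 'a::euclidean_space"
  assumes J: "finite J" and v: "v \<in> feasible J a b"
    and opt: "\<And>y. y \<in> feasible J a b \<Longrightarrow> c \<bullet> v \<le> c \<bullet> y"
  shows "\<exists>\<nu>. (\<forall>j\<in>tight J a b v. 0 \<le> \<nu> j) \<and> c = (\<Sum>j\<in>tight J a b v. \<nu> j *\<^sub>R a j)"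
proof -
  let ?T = "tight J a b v" and ?K = "convex_cone hull (a ` tight J a b v)"
  have fT: "finite ?T"
    using J by (simp add: tight_def)
  have "c \<in> ?K"
  proof (rule ccontr)
    assume "c \<notin> ?K"
    moreover have "convex ?K" "closed ?K"
      using fT by (auto simp: convex_convex_cone_hull closed_convex_cone_hull)
    ultimately obtain z \<beta> where z: "z \<bullet> c < \<beta>" "\<And>x. x \<in> ?K \<Longrightarrow> \<beta> < z \<bullet> x"
      using separating_hyperplane_closed_point[of ?K c] by auto
    have "\<beta> < 0"
      using z(2)[OF convex_cone_hull_contains_0] by simp
    have nn: "0 \<le> a j \<bullet> z" if "j \<in> ?T" for j
    proof (rule ccontr)
      assume neg: "\<not> 0 \<le> a j \<bullet> z"
      \<comment> \<open>This multiple of \<open>a j\<close> lies in the cone, yet its inner product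
        with \<open>z\<close> is exactly \<open>\<beta>\<close>, against strict separation.\<close>
      then have "(\<beta> / (a j \<bullet> z)) *\<^sub>R a j \<in> ?K"
        using that \<open>\<beta> < 0\<close> by (intro convex_cone_hull_mul hull_inc) (auto simp: divide_simps)
      then show False
        using z(2) neg by (force simp: inner_commute)
    qed
    have "\<forall>\<^sub>F t in at_right (0::real). b j \<le> a j \<bullet> (v + t *\<^sub>R z)" if "j \<in> J" for j
    proof (cases "j \<in> ?T")
      case True
      then have "b j \<le> a j \<bullet> (v + t *\<^sub>R z)" if "0 < t" for t
        using nn[OF True] that by (simp add: tight_def inner_add_right)
      then show ?thesis
        using eventually_at_right_less[of 0] by (auto elim: eventually_mono)
    next
      case False
      have "((\<lambda>t. a j \<bullet> (v + t *\<^sub>R z)) \<longlongrightarrow> a j \<bullet> v) (at_right 0)"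
        by (auto intro!: tendsto_eq_intros)
      moreover have "b j < a j \<bullet> v"
        using v False that by (force simp: feasible_def tight_def)
      ultimately show ?thesis
        by (rule eventually_mono[OF order_tendstoD(1)]) simp
    qed
    then have "\<forall>\<^sub>F t in at_right (0::real). \<forall>j\<in>J. b j \<le> a j \<bullet> (v + t *\<^sub>R z)"
      using J by (simp add: eventually_ball_finite)
    then have "\<forall>\<^sub>F t in at_right (0::real). 0 < t \<and> (\<forall>j\<in>J. b j \<le> a j \<bullet> (v + t *\<^sub>R z))"
      by (intro eventually_conj eventually_at_right_less)
    then obtain t :: real where t: "0 < t" "\<forall>j\<in>J. b j \<le> a j \<bullet> (v + t *\<^sub>R z)"
      using eventually_happens[of _ "at_right (0::real)"] by auto
    then have "c \<bullet> v \<le> c \<bullet> (v + t *\<^sub>R z)"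
      by (intro opt) (auto simp: feasible_def)
    then have "0 \<le> t * (c \<bullet> z)"
      by (simp add: inner_add_right)
    moreover have "c \<bullet> z < 0"
      using z(1) \<open>\<beta> < 0\<close> by (simp add: inner_commute)
    ultimately show False
      using t(1) by (simp add: zero_le_mult_iff)
  qed
  then show ?thesis
    using cone_hull_image_sum[OF _ fT] by blast
qed

section \<open>Patterns of tight constraints under a generic perturbation\<close>

text \<open>The nonempty faces of the polyhedron, each encoded by the constraints tight on its
  relative interior.\<close>

definition patterns :: "'j set \<Rightarrow> ('j \<Rightarrow> 'a::euclidean_space) \<Rightarrow> ('j \<Rightarrow> real) \<Rightarrow> 'j set set"
  where "patterns J a b = tight J a b ` feasible J a b"

text \<open>The relation is indexed by constraints and not by vectors, because several constraints
  may share a normal; two equal normals are already related by \<open>1\<close> and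
  \<open>- 1\<close>.\<close>

lemma exists_linear_relation:
  fixes a :: "'j \<Rightarrow> 'a::euclidean_space"
  assumes "finite S" "dim (a ` S) < card S"
  shows "\<exists>\<mu>. (\<exists>j\<in>S. \<mu> j \<noteq> 0) \<and> (\<Sum>j\<in>S. \<mu> j *\<^sub>R a j) = 0"
proof (cases "inj_on a S")
  case True
  then have "dependent (a ` S)"
    using assms independent_card_le_dim[of "a ` S" "a ` S"] card_image[OF True] by auto
  then obtain u where "\<exists>w\<in>a ` S. u w \<noteq> 0" "(\<Sum>w\<in>a ` S. u w *\<^sub>R w) = 0"
    using assms(1) by (auto simp: dependent_finite)
  then show ?thesis
    using True by (intro exI[of _ "\<lambda>j. u (a j)"]) (auto simp: sum.reindex)
next
  case False
  then obtain i j where ij: "i \<in> S" "j \<in> S" "a i = a j" "i \<noteq> j"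
    by (auto simp: inj_on_def)
  let ?\<mu> = "\<lambda>k. if k = i then 1 else if k = j then - 1 else (0::real)"
  have "(\<Sum>k\<in>S. ?\<mu> k *\<^sub>R a k) = (\<Sum>k\<in>{i, j}. ?\<mu> k *\<^sub>R a k)"
    using assms(1) ij by (intro sum.mono_neutral_right) auto
  then have "(\<Sum>k\<in>S. ?\<mu> k *\<^sub>R a k) = 0"
    using ij by simp
  then show ?thesis
    using ij by (intro exI[of _ ?\<mu>]) auto
qed

text \<open>The expression is a polynomial in \<open>\<delta>\<close>. Distinct positive exponents
  keep the coefficients \<open>\<mu> j\<close> from cancelling each other or merging with
  \<open>C\<close>, so it is nonzero and has finitely many roots.\<close>

lemma eventually_power_sum_nonzero:
  fixes \<mu> :: "'j \<Rightarrow> real"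
  assumes "finite S" "inj_on g S" "\<exists>j\<in>S. \<mu> j \<noteq> 0"
  shows "\<forall>\<^sub>F \<delta> in at_right 0. C - (\<Sum>j\<in>S. \<mu> j * \<delta> ^ Suc (g j)) \<noteq> 0"
proof -
  define p where "p = [:C:] - (\<Sum>j\<in>S. monom (\<mu> j) (Suc (g j)))"
  obtain i where i: "i \<in> S" "\<mu> i \<noteq> 0"
    using assms(3) by auto
  have "coeff p (Suc (g i)) = - (\<Sum>j\<in>S. if g j = g i then \<mu> j else 0)"
    by (simp add: p_def coeff_sum coeff_monom)
  also have "\<dots> = - (\<Sum>j\<in>S. if j = i then \<mu> j else 0)"
    using assms(2) i by (intro arg_cong[of _ _ uminus] sum.cong) (auto simp: inj_on_def)
  finally have "p \<noteq> 0"
    using assms(1) i by auto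
  then have "finite {x. poly p x = 0}"
    by (rule poly_roots_finite)
  then have "closed ({x. poly p x = 0} - {0})"
    by (intro finite_imp_closed) simp
  then have "\<forall>\<^sub>F x in nhds 0. x \<in> - ({x. poly p x = 0} - {0})"
    by (intro eventually_nhds_in_open open_Compl) auto
  then have "\<forall>\<^sub>F x in at_right 0. x \<in> - ({x. poly p x = 0} - {0})"
    by (auto simp: eventually_at_filter elim: eventually_mono)
  then have "\<forall>\<^sub>F x in at_right 0. poly p x \<noteq> 0"
    using eventually_at_right_less[of 0] by eventually_elim auto
  moreover have "poly p x = C - (\<Sum>j\<in>S. \<mu> j * x ^ Suc (g j))" for x
    by (simp add: p_def poly_sum poly_monom)
  ultimately show ?thesis
    by simp
qed

text \<open>Approximate complementary slackness. Writing \<open>c\<close> in two ways bounds the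
  weighted slack of \<open>W\<close> at \<open>x\<close> by the total perturbation of
  \<open>T\<close>, so by \<open>small\<close> the support of \<open>\<nu>\<close> lies inside
  \<open>T\<close>. Conversely, tightness on the support fixes the value of \<open>c\<close>, which
  forces all of \<open>T\<close> to be tight. So the support alone determines
  \<open>T\<close>.\<close>

lemma pattern_from_basic_point:
  fixes a :: "'j \<Rightarrow> 'a::euclidean_space"
  assumes J: "finite J" and x: "x \<in> feasible J a b" and T: "T = tight J a b x"
    and e: "\<And>j. j \<in> J \<Longrightarrow> 0 \<le> e j"
    and v: "v \<in> feasible J a (\<lambda>j. b j - e j)" "c \<bullet> v \<le> c \<bullet> x"
    and c: "c = (\<Sum>j\<in>T. a j)" "c = (\<Sum>j\<in>W. \<nu> j *\<^sub>R a j)"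
    and W: "W = tight J a (\<lambda>j. b j - e j) v" and nn: "\<And>j. j \<in> W \<Longrightarrow> 0 \<le> \<nu> j"
    and small: "\<And>j. j \<in> W - T \<Longrightarrow> 0 < \<nu> j \<Longrightarrow> (\<Sum>i\<in>T. e i) < \<nu> j * (a j \<bullet> x - b j)"
  shows "T = {j \<in> J. \<forall>y\<in>feasible J a b. {i\<in>W. 0 < \<nu> i} \<subseteq> tight J a b y \<longrightarrow> j \<in> tight J a b y}"
proof -
  have fin: "finite T" "finite W" and sub: "T \<subseteq> J" "W \<subseteq> J"
    using J by (auto simp: T W tight_def)
  have tx: "a j \<bullet> x = b j" if "j \<in> T" for j
    using that by (simp add: T tight_def)
  have slack: "0 \<le> \<nu> j * (a j \<bullet> x - b j)" if "j \<in> W" for j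
    using that nn x sub by (auto simp: feasible_def)
  have "(\<Sum>j\<in>W. \<nu> j * (a j \<bullet> x - b j)) \<le> (\<Sum>j\<in>W. \<nu> j * (a j \<bullet> x - a j \<bullet> v))"
  proof (rule sum_mono)
    fix j assume j: "j \<in> W"
    then have "a j \<bullet> v \<le> b j"
      using e[of j] sub by (auto simp: W tight_def)
    then show "\<nu> j * (a j \<bullet> x - b j) \<le> \<nu> j * (a j \<bullet> x - a j \<bullet> v)"
      using nn[OF j] by (intro mult_left_mono) auto
  qed
  also have "\<dots> = c \<bullet> x - c \<bullet> v"
    by (simp add: c(2) inner_sum_left right_diff_distrib sum_subtractf)
  also have "\<dots> = (\<Sum>j\<in>T. b j - a j \<bullet> v)"
    using tx by (simp add: c(1) inner_sum_left sum_subtractf)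
  also have "\<dots> \<le> (\<Sum>j\<in>T. e j)"
    using v(1) sub by (intro sum_mono) (auto simp: feasible_def algebra_simps)
  finally have total: "(\<Sum>j\<in>W. \<nu> j * (a j \<bullet> x - b j)) \<le> (\<Sum>j\<in>T. e j)" .
  have WT: "j \<in> T" if "j \<in> W" "0 < \<nu> j" for j
  proof (rule ccontr)
    assume "j \<notin> T"
    then have "(\<Sum>i\<in>T. e i) < \<nu> j * (a j \<bullet> x - b j)"
      using small that by blast
    also have "\<dots> \<le> (\<Sum>j\<in>W. \<nu> j * (a j \<bullet> x - b j))"
      using member_le_sum[of j W "\<lambda>j. \<nu> j * (a j \<bullet> x - b j)"] slack that fin by auto
    finally show False
      using total by simp
  qed
  have cs: "c = (\<Sum>j\<in>{i\<in>W. 0 < \<nu> i}. \<nu> j *\<^sub>R a j)"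
    unfolding c(2) using fin(2) nn by (intro sum.mono_neutral_right) force+
  have "j \<in> tight J a b y"
    if j: "j \<in> T" and y: "y \<in> feasible J a b" "{i\<in>W. 0 < \<nu> i} \<subseteq> tight J a b y" for j y
  proof -
    \<comment> \<open>The normals in the support have the same values at \<open>x\<close> and
      \<open>y\<close>, hence so has \<open>c\<close>. Written as the sum over \<open>T\<close>,
      this says that the nonnegative slacks of \<open>T\<close> at \<open>y\<close> add up to
      zero.\<close>
    have "c \<bullet> y = c \<bullet> x"
      unfolding cs inner_sum_left using y(2) WT tx
      by (intro sum.cong) (force simp: tight_def)+
    then have "(\<Sum>j\<in>T. a j \<bullet> y - b j) = 0"
      using tx by (simp add: c(1) inner_sum_left sum_subtractf)
    then have "a j \<bullet> y - b j = 0"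
      using sum_nonneg_eq_0_iff[OF fin(1), of "\<lambda>j. a j \<bullet> y - b j"] y(1) sub j
      by (auto simp: feasible_def)
    then show ?thesis
      using j sub by (auto simp: tight_def)
  qed
  moreover have "{i\<in>W. 0 < \<nu> i} \<subseteq> T"
    using WT by auto
  ultimately show ?thesis
    using x sub unfolding T by blast
qed

lemma card_patterns_le_basic_points:
  fixes a :: "'j \<Rightarrow> 'a::euclidean_space"
  assumes J: "finite J"
  obtains b' where "card (patterns J a b) \<le> card (basic_points J a b') * 2 ^ dim (a ` J)"
proof -
  let ?D = "dim (a ` J)"
  obtain g :: "'j \<Rightarrow> nat" where g: "inj_on g J"
    using finite_imp_inj_to_nat_seg[OF J] by blast
  define c where "c T = (\<Sum>j\<in>T. a j)" for T
  define X where "X T = (SOME x. x \<in> feasible J a b \<and> tight J a b x = T)" for T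
  have X: "X T \<in> feasible J a b" "tight J a b (X T) = T" if "T \<in> patterns J a b" for T
  proof -
    have "\<exists>x. x \<in> feasible J a b \<and> tight J a b x = T"
      using that by (auto simp: patterns_def)
    then have "X T \<in> feasible J a b \<and> tight J a b (X T) = T"
      unfolding X_def by (rule someI_ex)
    then show "X T \<in> feasible J a b" "tight J a b (X T) = T"
      by auto
  qed
  have TJ: "T \<subseteq> J" if "T \<in> patterns J a b" for T
    using that by (auto simp: patterns_def tight_def)
  have finP: "finite (patterns J a b)"
    using finite_subset[of "patterns J a b" "Pow J"] TJ J by auto
  \<comment> \<open>The multipliers depend on \<open>T\<close> and \<open>W\<close> and not on
    \<open>\<delta>\<close>. Both range over finite families, so only finitely many conditions
    restrict \<open>\<delta>\<close>. Where no multipliers exist, the arbitrary value merely adds a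
    condition that small \<open>\<delta>\<close> also satisfies.\<close>
  define \<nu> where "\<nu> T W = (SOME \<nu>. (\<forall>j\<in>W. 0 \<le> \<nu> j) \<and> c T = (\<Sum>j\<in>W. \<nu> j *\<^sub>R a j))" for T W
  \<comment> \<open>\<open>Suc\<close> makes every perturbation vanish as \<open>\<delta>\<close>
    tends to 0, including the one with \<open>g j = 0\<close>.\<close>
  let ?e = "\<lambda>\<delta>::real. \<lambda>j. \<delta> ^ Suc (g j)"
  define rel where "rel S = (SOME \<mu>. (\<exists>j\<in>S. \<mu> j \<noteq> 0) \<and> (\<Sum>j\<in>S. \<mu> j *\<^sub>R a j) = 0)" for S
  have rel: "\<exists>j\<in>S. rel S j \<noteq> 0" "(\<Sum>j\<in>S. rel S j *\<^sub>R a j) = 0" if "S \<subseteq> J" "card S = Suc ?D" for S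
  proof -
    have "dim (a ` S) < card S"
      using that dim_subset[of "a ` S" "a ` J"] by (simp add: image_mono less_Suc_eq_le)
    then have "\<exists>\<mu>. (\<exists>j\<in>S. \<mu> j \<noteq> 0) \<and> (\<Sum>j\<in>S. \<mu> j *\<^sub>R a j) = 0"
      using that J finite_subset by (intro exists_linear_relation) auto
    then have "(\<exists>j\<in>S. rel S j \<noteq> 0) \<and> (\<Sum>j\<in>S. rel S j *\<^sub>R a j) = 0"
      unfolding rel_def by (rule someI_ex)
    then show "\<exists>j\<in>S. rel S j \<noteq> 0" "(\<Sum>j\<in>S. rel S j *\<^sub>R a j) = 0"
      by auto
  qed
  have "\<forall>\<^sub>F \<delta> in at_right 0. (\<Sum>j\<in>S. rel S j * b j) - (\<Sum>j\<in>S. rel S j * ?e \<delta> j) \<noteq> 0"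
    if "S \<subseteq> J" "card S = Suc ?D" for S
    using that J finite_subset rel(1)[OF that] inj_on_subset[OF g]
    by (intro eventually_power_sum_nonzero) auto
  then have gen: "\<forall>\<^sub>F \<delta> in at_right 0. \<forall>S\<in>{S\<in>Pow J. card S = Suc ?D}.
      (\<Sum>j\<in>S. rel S j * b j) - (\<Sum>j\<in>S. rel S j * ?e \<delta> j) \<noteq> 0"
    using J by (intro eventually_ball_finite) auto
  have "\<forall>\<^sub>F \<delta> in at_right 0. (\<Sum>i\<in>T. ?e \<delta> i) < \<nu> T W j * (a j \<bullet> X T - b j)"
    if "T \<in> patterns J a b" "j \<in> J - T" "0 < \<nu> T W j" for T W j
  proof (rule order_tendstoD(2))
    show "((\<lambda>\<delta>. \<Sum>i\<in>T. ?e \<delta> i) \<longlongrightarrow> (\<Sum>i\<in>T. ?e 0 i)) (at_right 0)"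
      by (intro tendsto_intros)
    have "b j < a j \<bullet> X T"
      using X[OF that(1)] that(2) by (force simp: feasible_def tight_def)
    then show "(\<Sum>i\<in>T. ?e 0 i) < \<nu> T W j * (a j \<bullet> X T - b j)"
      using that(3) by simp
  qed
  then have "\<forall>\<^sub>F \<delta> in at_right 0. \<forall>T\<in>patterns J a b. \<forall>W\<in>Pow J. \<forall>j\<in>{j\<in>J - T. 0 < \<nu> T W j}.
      (\<Sum>i\<in>T. ?e \<delta> i) < \<nu> T W j * (a j \<bullet> X T - b j)"
    using J finP by (intro eventually_ball_finite ballI) auto
  then have "\<forall>\<^sub>F \<delta> in at_right 0. 0 < \<delta> \<and>
      (\<forall>S\<in>{S\<in>Pow J. card S = Suc ?D}. (\<Sum>j\<in>S. rel S j * b j) - (\<Sum>j\<in>S. rel S j * ?e \<delta> j) \<noteq> 0) \<and>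
      (\<forall>T\<in>patterns J a b. \<forall>W\<in>Pow J. \<forall>j\<in>{j\<in>J - T. 0 < \<nu> T W j}.
        (\<Sum>i\<in>T. ?e \<delta> i) < \<nu> T W j * (a j \<bullet> X T - b j))"
    using gen by (intro eventually_conj eventually_at_right_less)
  then obtain \<delta> :: real where \<delta>: "0 < \<delta>"
      and gen: "\<And>S. S \<subseteq> J \<Longrightarrow> card S = Suc ?D \<Longrightarrow> (\<Sum>j\<in>S. rel S j * b j) - (\<Sum>j\<in>S. rel S j * ?e \<delta> j) \<noteq> 0"
      and small: "\<And>T W j. T \<in> patterns J a b \<Longrightarrow> W \<subseteq> J \<Longrightarrow> j \<in> J - T \<Longrightarrow> 0 < \<nu> T W j \<Longrightarrow>
        (\<Sum>i\<in>T. ?e \<delta> i) < \<nu> T W j * (a j \<bullet> X T - b j)"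
    using eventually_happens'[OF trivial_limit_at_right_real] by blast
  define e where "e = ?e \<delta>"
  define b' where "b' j = b j - e j" for j
  let ?T = "tight J a b'"
  \<comment> \<open>Among \<open>?D + 1\<close> tight constraints, the linear relation between the
    normals would carry over to the values \<open>b' j\<close>, which the choice of
    \<open>\<delta>\<close> excludes.\<close>
  have card_tight: "card (?T y) \<le> ?D" for y
  proof (rule ccontr)
    assume "\<not> card (?T y) \<le> ?D"
    then obtain S where S: "S \<subseteq> ?T y" "card S = Suc ?D"
      by (meson not_less_eq_eq obtain_subset_with_card_n)
    then have SJ: "S \<subseteq> J"
      by (auto simp: tight_def)
    have "(\<Sum>j\<in>S. rel S j * b' j) = (\<Sum>j\<in>S. rel S j *\<^sub>R a j) \<bullet> y"
      using S(1) by (auto simp: inner_sum_left tight_def intro!: sum.cong)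
    also have "\<dots> = 0"
      using rel(2)[OF SJ S(2)] by simp
    finally show False
      using gen[OF SJ S(2)] by (simp add: b'_def e_def right_diff_distrib sum_subtractf)
  qed
  \<comment> \<open>The constraints that become tight as soon as those in \<open>W\<close> are: the
    closure that rebuilds a pattern from the support of its multipliers.\<close>
  define cl where "cl W = {j \<in> J. \<forall>y\<in>feasible J a b. W \<subseteq> tight J a b y \<longrightarrow> j \<in> tight J a b y}" for W
  have "T \<in> (\<Union>v\<in>basic_points J a b'. cl ` Pow (?T v))" if T: "T \<in> patterns J a b" for T
  proof -
    have XT: "X T \<in> feasible J a b'"
      unfolding feasible_def
    proof clarify
      fix j assume "j \<in> J"
      then have "b j \<le> a j \<bullet> X T"
        using X(1)[OF T] by (simp add: feasible_def)
      moreover have "0 \<le> e j"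
        using \<delta> by (simp add: e_def)
      ultimately show "b' j \<le> a j \<bullet> X T"
        by (simp add: b'_def)
    qed
    have cT: "0 \<le> c T \<bullet> z" if "\<And>j. j \<in> J \<Longrightarrow> 0 \<le> a j \<bullet> z" for z
      using that TJ[OF T] by (auto simp: c_def inner_sum_left intro!: sum_nonneg)
    have cU: "c T \<in> span (a ` J)"
      unfolding c_def using TJ[OF T] by (intro span_sum span_base) auto
    note below = basic_point_below[OF J _ cT cU]
    have "basic_points J a b' \<noteq> {}"
      using below[OF XT] by blast
    \<comment> \<open>Below every feasible point there is a basic point for \<open>c T\<close>, so
      the best of the finitely many basic points is optimal.\<close>
    then obtain v where v: "v \<in> basic_points J a b'"
      and min: "\<And>w. w \<in> basic_points J a b' \<Longrightarrow> c T \<bullet> v \<le> c T \<bullet> w"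
      using ex_is_arg_min_if_finite[OF card_basic_points(1)[OF J], of a b' "\<lambda>w. c T \<bullet> w"]
      by (auto simp: is_arg_min_linorder)
    have opt: "c T \<bullet> v \<le> c T \<bullet> y" if y: "y \<in> feasible J a b'" for y
      using below[OF y] min order_trans by metis
    have vf: "v \<in> feasible J a b'"
      using v by (simp add: basic_points_def)
    have "\<exists>\<nu>. (\<forall>j\<in>?T v. 0 \<le> \<nu> j) \<and> c T = (\<Sum>j\<in>?T v. \<nu> j *\<^sub>R a j)"
      by (rule optimal_multipliers[OF J vf opt])
    then have \<nu>: "(\<forall>j\<in>?T v. 0 \<le> \<nu> T (?T v) j) \<and> c T = (\<Sum>j\<in>?T v. \<nu> T (?T v) j *\<^sub>R a j)"
      unfolding \<nu>_def by (rule someI_ex)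
    have vJ: "?T v \<subseteq> J"
      by (auto simp: tight_def)
    have b': "b' = (\<lambda>j. b j - e j)"
      by (rule ext) (rule b'_def)
    have "T = cl {i\<in>?T v. 0 < \<nu> T (?T v) i}"
      unfolding cl_def
    proof (rule pattern_from_basic_point[OF J X(1)[OF T], of T e v "c T"])
      show "T = tight J a b (X T)" using X(2)[OF T] by simp
      show "0 \<le> e j" for j using \<delta> by (simp add: e_def)
      show "v \<in> feasible J a (\<lambda>j. b j - e j)" using vf b' by simp
      show "c T \<bullet> v \<le> c T \<bullet> X T" by (rule opt[OF XT])
      show "c T = sum a T" by (simp add: c_def)
      show "c T = (\<Sum>j\<in>?T v. \<nu> T (?T v) j *\<^sub>R a j)" using \<nu> by blast
      show "?T v = tight J a (\<lambda>j. b j - e j) v" by (simp only: b')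
      show "0 \<le> \<nu> T (?T v) j" if "j \<in> ?T v" for j using \<nu> that by blast
      show "sum e T < \<nu> T (?T v) j * (a j \<bullet> X T - b j)"
        if "j \<in> ?T v - T" "0 < \<nu> T (?T v) j" for j
        unfolding e_def using small[OF T vJ] that vJ by blast
    qed
    then show ?thesis
      using v by blast
  qed
  then have "patterns J a b \<subseteq> (\<Union>v\<in>basic_points J a b'. cl ` Pow (?T v))"
    by blast
  moreover have fT: "finite (?T v)" for v
    using J by (simp add: tight_def)
  moreover note fB = card_basic_points(1)[OF J, of a b']
  ultimately have "card (patterns J a b) \<le> card (\<Union>v\<in>basic_points J a b'. cl ` Pow (?T v))"
    by (intro card_mono) auto
  also have "\<dots> \<le> (\<Sum>v\<in>basic_points J a b'. card (cl ` Pow (?T v)))"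
    by (rule card_UN_le[OF fB])
  also have "\<dots> \<le> (\<Sum>v\<in>basic_points J a b'. 2 ^ ?D)"
  proof (rule sum_mono)
    fix v
    have "card (cl ` Pow (?T v)) \<le> 2 ^ card (?T v)"
      using card_image_le[of "Pow (?T v)" cl] fT by (simp add: card_Pow)
    also have "\<dots> \<le> 2 ^ ?D"
      using card_tight by (intro power_increasing) auto
    finally show "card (cl ` Pow (?T v)) \<le> 2 ^ ?D" .
  qed
  finally show ?thesis
    using that by simp
qed

lemma card_small_subsets:
  assumes "finite J" "J \<noteq> {}"
  shows "card {N. N \<subseteq> J \<and> card N \<le> k} \<le> Suc k * card J ^ k"
proof -
  have "{N. N \<subseteq> J \<and> card N \<le> k} = (\<Union>i\<le>k. {N. N \<subseteq> J \<and> card N = i})"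
    by auto
  then have "card {N. N \<subseteq> J \<and> card N \<le> k} \<le> (\<Sum>i\<le>k. card {N. N \<subseteq> J \<and> card N = i})"
    using card_UN_le[of "{..k}" "\<lambda>i. {N. N \<subseteq> J \<and> card N = i}"] by simp
  also have "\<dots> \<le> (\<Sum>i\<le>k. card J ^ k)"
  proof (rule sum_mono)
    fix i assume i: "i \<in> {..k}"
    have "card {N. N \<subseteq> J \<and> card N = i} \<le> card J ^ i"
      using n_subsets[OF assms(1), of i] binomial_le_pow[of i "card J"]
      by (cases "i \<le> card J") (auto simp: binomial_eq_0)
    also have "\<dots> \<le> card J ^ k"
      using i assms by (intro power_increasing) (auto simp: Suc_le_eq card_gt_0_iff)
    finally show "card {N. N \<subseteq> J \<and> card N = i} \<le> card J ^ k" .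
  qed
  finally show ?thesis by simp
qed

text \<open>The exponent \<open>D div 2\<close> comes from the count of basic points; passing to
  patterns costs a factor of at most \<open>2 ^ D\<close>.\<close>

theorem card_patterns_le:
  fixes a :: "'j \<Rightarrow> 'a::euclidean_space"
  assumes J: "finite J" "J \<noteq> {}" and D: "dim (a ` J) \<le> D"
  shows "card (patterns J a b) \<le> 2 ^ Suc D * Suc (D div 2) * card J ^ (D div 2)"
proof -
  let ?F = "\<lambda>k. {N. N \<subseteq> J \<and> card N \<le> k}"
  obtain b' where "card (patterns J a b) \<le> card (basic_points J a b') * 2 ^ dim (a ` J)"
    using card_patterns_le_basic_points[OF J(1)] .
  also have "\<dots> \<le> (2 * card (?F (dim (a ` J) div 2))) * 2 ^ D"
    using card_basic_points(2)[OF J(1), of a b'] D by (intro mult_mono power_increasing) auto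
  also have "card (?F (dim (a ` J) div 2)) \<le> card (?F (D div 2))"
    using J D div_le_mono[OF D, of 2] by (intro card_mono) auto
  also have "card (?F (D div 2)) \<le> Suc (D div 2) * card J ^ (D div 2)"
    by (rule card_small_subsets[OF J])
  finally show ?thesis
    by (simp add: algebra_simps)
qed

section \<open>Faces of Minkowski sums\<close>

text \<open>Pairs keep the summands apart even if the sets \<open>V i\<close> overlap, and they are
  the indices of the inequalities used in the Cayley trick.\<close>

definition max_pattern :: "nat \<Rightarrow> (nat \<Rightarrow> 'a::euclidean_space set) \<Rightarrow> 'a \<Rightarrow> (nat \<times> 'a) set"
  where "max_pattern r V u = {(i, v). i < r \<and> v \<in> V i \<and> (\<forall>w\<in>V i. u \<bullet> w \<le> u \<bullet> v)}"

lemma sum_sets_memI: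
  fixes s :: "nat \<Rightarrow> 'a::comm_monoid_add"
  shows "(\<And>i. i < r \<Longrightarrow> s i \<in> V i) \<Longrightarrow> (\<Sum>i<r. s i) \<in> (\<Sum>i<r. V i)"
  by (subst set_sum_alt) auto

lemma sum_sets_memD:
  fixes V :: "nat \<Rightarrow> 'a::comm_monoid_add set"
  shows "x \<in> (\<Sum>i<r. V i) \<Longrightarrow> \<exists>s. (\<forall>i<r. s i \<in> V i) \<and> x = (\<Sum>i<r. s i)"
  by (subst (asm) set_sum_alt) auto

lemma inner_sum_upd:
  fixes u :: "'a::real_inner" and s :: "nat \<Rightarrow> 'a"
  assumes "i < r"
  shows "u \<bullet> (\<Sum>j<r. (s(i := w)) j) = u \<bullet> (\<Sum>j<r. s j) - u \<bullet> s i + u \<bullet> w"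
proof -
  have "(\<Sum>j<r. f j) = f i + (\<Sum>j\<in>{..<r} - {i}. f j)" for f :: "nat \<Rightarrow> 'a"
    using assms by (simp add: sum.remove)
  from this[of s] this[of "s(i := w)"] show ?thesis
    by (simp add: inner_add_right)
qed

lemma finite_sum_sets:
  assumes "\<And>i. i < r \<Longrightarrow> finite (V i)"
  shows "finite (\<Sum>i<(r::nat). (V i :: 'a::comm_monoid_add set))"
proof -
  have "(\<Sum>i<r. V i) \<subseteq> (\<lambda>s. \<Sum>i<r. s i) ` PiE {..<r} V"
  proof
    fix x assume "x \<in> (\<Sum>i<r. V i)"
    then obtain s where s: "\<And>i. i < r \<Longrightarrow> s i \<in> V i" "x = (\<Sum>i<r. s i)"
      using sum_sets_memD by blast
    then have "x = (\<Sum>i<r. restrict s {..<r} i)" "restrict s {..<r} \<in> PiE {..<r} V"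
      by auto
    then show "x \<in> (\<lambda>s. \<Sum>i<r. s i) ` PiE {..<r} V"
      by blast
  qed
  then show ?thesis
    using assms by (meson finite_PiE finite_imageI finite_lessThan finite_subset lessThan_iff)
qed

text \<open>A nonempty face is exposed by some \<open>u\<close>, and it is the hull of the sums of
  maximisers of \<open>u\<close> in the single \<open>V i\<close>; the pattern of \<open>u\<close>
  therefore determines it. \<open>Suc\<close> counts the empty face.\<close>

lemma complexity_sum_le:
  fixes V :: "nat \<Rightarrow> 'a::euclidean_space set"
  assumes fin: "\<And>i. i < r \<Longrightarrow> finite (V i)" and finR: "finite (range (max_pattern r V))"
  shows "complexity (\<Sum>i<r. convex hull (V i)) \<le> Suc (card (range (max_pattern r V)))"
proof -
  let ?W = "\<Sum>i<r. V i"
  have S: "(\<Sum>i<r. convex hull (V i)) = convex hull ?W"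
    by (simp add: convex_hull_set_sum)
  have fW: "finite ?W"
    using fin by (rule finite_sum_sets)
  define G where "G Pt = {\<Sum>i<r. s i | s. \<forall>i<r. (i, s i) \<in> Pt}" for Pt :: "(nat \<times> 'a) set"
  have "F \<in> insert {} ((\<lambda>Pt. convex hull (G Pt)) ` range (max_pattern r V))"
    if F: "F face_of convex hull ?W" for F
  proof (cases "F = {}")
    case False
    have "polyhedron (convex hull ?W)"
      using fW by (simp add: polyhedron_convex_hull)
    then have "F exposed_face_of convex hull ?W"
      using F exposed_face_of_polyhedron by blast
    then obtain u c where uc: "convex hull ?W \<subseteq> {x. u \<bullet> x \<le> c}" "F = convex hull ?W \<inter> {x. u \<bullet> x = c}"
      by (auto simp: exposed_face_of_def)
    have WH: "?W \<subseteq> convex hull ?W"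
      by (rule hull_subset)
    obtain S' where S': "S' \<subseteq> ?W" "F = convex hull S'"
      using face_of_convex_hull_subset[OF finite_imp_compact[OF fW] F] by blast
    have FW: "F = convex hull (F \<inter> ?W)"
    proof
      show "F \<subseteq> convex hull (F \<inter> ?W)"
        using S' hull_subset[of S' convex] hull_mono[of S' "F \<inter> ?W" convex] by auto
      show "convex hull (F \<inter> ?W) \<subseteq> F"
        using F face_of_imp_convex by (intro hull_minimal) auto
    qed
    have "F \<inter> ?W = G (max_pattern r V u)"
    proof
      show "F \<inter> ?W \<subseteq> G (max_pattern r V u)"
      proof
        fix x assume x: "x \<in> F \<inter> ?W"
        then obtain s where s: "\<And>i. i < r \<Longrightarrow> s i \<in> V i" "x = (\<Sum>i<r. s i)"
          by (auto dest!: sum_sets_memD)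
        \<comment> \<open>Exchange argument: replacing one summand of a maximal sum cannot increase
          \<open>u\<close>, so each summand is maximal in its own set.\<close>
        have "u \<bullet> w \<le> u \<bullet> s i" if "i < r" "w \<in> V i" for i w
        proof -
          have "(\<Sum>j<r. (s(i := w)) j) \<in> ?W"
            using s(1) that by (intro sum_sets_memI) auto
          then have "u \<bullet> (\<Sum>j<r. (s(i := w)) j) \<le> c"
            using uc(1) WH by blast
          moreover have "u \<bullet> (\<Sum>j<r. s j) = c"
            using x uc(2) s(2) by auto
          ultimately show ?thesis
            using inner_sum_upd[OF that(1), of u s w] by linarith
        qed
        then show "x \<in> G (max_pattern r V u)"
          using s by (auto simp: G_def max_pattern_def)
      qed
      show "G (max_pattern r V u) \<subseteq> F \<inter> ?W"
      proof
        fix x assume "x \<in> G (max_pattern r V u)"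
        then obtain s where s: "\<And>i. i < r \<Longrightarrow> (i, s i) \<in> max_pattern r V u" "x = (\<Sum>i<r. s i)"
          by (auto simp: G_def)
        have xW: "x \<in> ?W"
          unfolding s(2) using s(1) by (intro sum_sets_memI) (auto simp: max_pattern_def)
        have "F \<inter> ?W \<noteq> {}"
          using FW False convex_hull_empty by metis
        then obtain y where y: "y \<in> F \<inter> ?W"
          by blast
        then obtain t where t: "\<And>i. i < r \<Longrightarrow> t i \<in> V i" "y = (\<Sum>i<r. t i)"
          by (auto dest!: sum_sets_memD)
        have "u \<bullet> y \<le> u \<bullet> x"
          unfolding s(2) t(2) inner_sum_right
          using s(1) t(1) by (intro sum_mono) (auto simp: max_pattern_def)
        moreover have "u \<bullet> y = c"
          using y uc(2) by auto
        moreover have "u \<bullet> x \<le> c"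
          using uc(1) WH xW by blast
        ultimately have "u \<bullet> x = c"
          by simp
        then show "x \<in> F \<inter> ?W"
          using xW WH uc(2) by blast
      qed
    qed
    then show ?thesis
      using FW by auto
  qed simp
  then have "{F. F face_of convex hull ?W} \<subseteq> insert {} ((\<lambda>Pt. convex hull (G Pt)) ` range (max_pattern r V))"
    by blast
  then have "complexity (convex hull ?W) \<le> card (insert {} ((\<lambda>Pt. convex hull (G Pt)) ` range (max_pattern r V)))"
    unfolding complexity_def by (rule card_mono[rotated]) (use finR in simp)
  also have "\<dots> \<le> Suc (card ((\<lambda>Pt. convex hull (G Pt)) ` range (max_pattern r V)))"
    using finR by (simp add: card_insert_if)
  also have "\<dots> \<le> Suc (card (range (max_pattern r V)))"
    using card_image_le[OF finR] by simp
  finally show ?thesis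
    by (simp only: S)
qed

text \<open>The pattern can be read off the face: a maximiser \<open>v\<close> in
  \<open>V i\<close>, completed by maximisers in the other sets, gives a point of the face, and
  exchanging its \<open>i\<close>-th summand shows that \<open>v\<close> is maximal for any
  \<open>u'\<close> with the same face.\<close>

lemma complexity_sum_ge:
  fixes V :: "nat \<Rightarrow> 'a::euclidean_space set"
  assumes fin: "\<And>i. i < r \<Longrightarrow> finite (V i)" and ne: "\<And>i. i < r \<Longrightarrow> V i \<noteq> {}"
    and inj: "inj_on (max_pattern r V) \<U>"
  shows "card \<U> \<le> complexity (\<Sum>i<r. convex hull (V i))"
proof -
  let ?W = "\<Sum>i<r. V i"
  let ?S = "convex hull ?W"
  have S: "(\<Sum>i<r. convex hull (V i)) = ?S"
    by (simp add: convex_hull_set_sum)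
  have fW: "finite ?W"
    using fin by (rule finite_sum_sets)
  have WH: "?W \<subseteq> ?S"
    by (rule hull_subset)
  define face where "face u = {x \<in> ?S. \<forall>y\<in>?S. u \<bullet> y \<le> u \<bullet> x}" for u
  have face: "face u face_of ?S" for u
  proof (cases "face u = {}")
    case False
    then obtain x where x: "x \<in> ?S" "\<And>y. y \<in> ?S \<Longrightarrow> u \<bullet> y \<le> u \<bullet> x"
      by (auto simp: face_def)
    then have "face u = ?S \<inter> {y. u \<bullet> y = u \<bullet> x}"
      by (force simp: face_def)
    then show ?thesis
      using face_of_Int_supporting_hyperplane_le[OF convex_convex_hull x(2)] by simp
  qed simp
  have sub: "max_pattern r V u \<subseteq> max_pattern r V u'" if eq: "face u = face u'" for u u'
  proof
    fix p assume "p \<in> max_pattern r V u"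
    then obtain i v where p: "p = (i, v)" and i: "i < r" "(i, v) \<in> max_pattern r V u"
      by (auto simp: max_pattern_def)
    have "\<exists>v. (j, v) \<in> max_pattern r V u" if "j < r" for j
      using ex_is_arg_min_if_finite[OF fin[OF that] ne[OF that], of "\<lambda>v. - (u \<bullet> v)"] that
      by (auto simp: is_arg_min_linorder max_pattern_def)
    then obtain t where t: "\<And>j. j < r \<Longrightarrow> (j, t j) \<in> max_pattern r V u"
      by metis
    define s where "s = t(i := v)"
    have s: "(j, s j) \<in> max_pattern r V u" if "j < r" for j
      using t[OF that] i by (simp add: s_def)
    let ?x = "\<Sum>j<r. s j"
    have sV: "s j \<in> V j" if "j < r" for j
      using s[OF that] by (simp add: max_pattern_def)
    have "?W \<subseteq> {y. u \<bullet> y \<le> u \<bullet> ?x}"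
    proof
      fix y assume "y \<in> ?W"
      then obtain q where "\<And>i. i < r \<Longrightarrow> q i \<in> V i" "y = (\<Sum>i<r. q i)"
        by (auto dest!: sum_sets_memD)
      then show "y \<in> {y. u \<bullet> y \<le> u \<bullet> ?x}"
        using s by (auto simp: inner_sum_right max_pattern_def intro!: sum_mono)
    qed
    then have "?S \<subseteq> {y. u \<bullet> y \<le> u \<bullet> ?x}"
      by (rule hull_minimal) (rule convex_halfspace_le)
    moreover have "?x \<in> ?S"
      by (rule subsetD[OF WH sum_sets_memI]) (rule sV)
    ultimately have "?x \<in> face u'"
      using eq by (auto simp: face_def)
    then have le: "u' \<bullet> y \<le> u' \<bullet> ?x" if "y \<in> ?W" for y
      using that WH by (auto simp: face_def)
    have "u' \<bullet> w \<le> u' \<bullet> v" if "w \<in> V i" for w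
    proof -
      have "(\<Sum>j<r. (s(i := w)) j) \<in> ?W"
        using sV that by (intro sum_sets_memI) auto
      from le[OF this] show ?thesis
        using inner_sum_upd[OF i(1), of u' s w] by (simp add: s_def)
    qed
    then show "p \<in> max_pattern r V u'"
      using i p by (auto simp: max_pattern_def)
  qed
  have "inj_on face \<U>"
  proof (rule inj_onI)
    fix u u' assume u: "u \<in> \<U>" "u' \<in> \<U>" "face u = face u'"
    then have "max_pattern r V u = max_pattern r V u'"
      using sub[of u u'] sub[of u' u] by auto
    then show "u = u'"
      using inj u by (auto dest: inj_onD)
  qed
  moreover have "face ` \<U> \<subseteq> {F. F face_of ?S}"
    using face by auto
  moreover have "finite {F. F face_of ?S}"
    using fW by (intro finite_polyhedron_faces polyhedron_convex_hull)
  ultimately have "card \<U> \<le> complexity ?S"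
    unfolding complexity_def by (rule card_inj_on_le)
  then show ?thesis
    by (simp only: S)
qed

section \<open>The upper bound by the Cayley trick\<close>

lemma max_pattern_scale:
  assumes "0 < k"
  shows "max_pattern r V (k *\<^sub>R u) = max_pattern r V u"
  using assms by (simp add: max_pattern_def)

text \<open>After positive scaling, a nonzero \<open>u\<close> has a coordinate
  \<open>\<gamma>\<close> equal to \<open>1\<close> or \<open>- 1\<close>. With that coordinate
  fixed, \<open>DIM('a) - 1\<close> coordinates of \<open>u\<close> and \<open>r\<close> heights
  remain as unknowns, which is \<open>D\<close>. The factor \<open>2 * DIM('a)\<close> counts the
  choices of coordinate and sign, and \<open>Suc\<close> the pattern of
  \<open>u = 0\<close>.\<close>

lemma card_max_patterns_le:
  fixes V :: "nat \<Rightarrow> 'a::euclidean_space set"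
  assumes fin: "\<And>i. i < r \<Longrightarrow> finite (V i)" and card: "\<And>i. i < r \<Longrightarrow> card (V i) = n"
    and n: "0 < n" and r: "0 < r" "r \<le> DIM('a)" and D: "D = DIM('a) + r - 1"
  shows "finite (range (max_pattern r V))"
    and "card (range (max_pattern r V)) \<le>
      Suc (2 * DIM('a) * (2 ^ Suc D * Suc (D div 2) * (r * n) ^ (D div 2)))"
proof -
  \<comment> \<open>The heights \<open>t_i\<close> are stored as coordinates along
    \<open>\<beta> i\<close> in a second copy of the space; \<open>r \<le> DIM('a)\<close> gives
    enough room.\<close>
  obtain \<beta> :: "nat \<Rightarrow> 'a" where \<beta>: "inj_on \<beta> {..<r}" "\<beta> ` {..<r} \<subseteq> Basis"
    using card_le_inj[of "{..<r}" "Basis :: 'a set"] r by auto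
  let ?J = "Sigma {..<r} V"
  \<comment> \<open>The inequality \<open>t_i \<ge> u \<bullet> v\<close> with the known term
    \<open>\<sigma> * (v \<bullet> \<gamma>)\<close> moved to the right-hand side \<open>b\<close>;
    this removes direction \<open>\<gamma>\<close> from the normal.\<close>
  define a where "a \<gamma> = (\<lambda>(i, v). (- (v - (v \<bullet> \<gamma>) *\<^sub>R \<gamma>), \<beta> i))" for \<gamma> :: 'a
  define b where "b \<gamma> \<sigma> = (\<lambda>(i :: nat, v). \<sigma> * (v \<bullet> \<gamma>))" for \<gamma> :: 'a and \<sigma> :: real
  have J: "finite ?J"
    using fin by auto
  have cJ: "card ?J = r * n"
    using fin card by (simp add: card_SigmaI)
  then have J0: "?J \<noteq> {}"
    using n r by (metis card.empty mult_is_0 less_irrefl)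
  have dim: "dim (a \<gamma> ` ?J) \<le> D" if \<gamma>: "\<gamma> \<in> Basis" for \<gamma>
  proof -
    let ?B = "(\<lambda>x. (x, 0)) ` (Basis - {\<gamma>}) \<union> (\<lambda>x. (0, x)) ` \<beta> ` {..<r} :: ('a \<times> 'a) set"
    have "a \<gamma> (i, v) \<in> span ?B" if "i < r" for i v
    proof -
      have "v = (\<Sum>x\<in>Basis. (v \<bullet> x) *\<^sub>R x)"
        by (simp add: euclidean_representation)
      also have "\<dots> = (v \<bullet> \<gamma>) *\<^sub>R \<gamma> + (\<Sum>x\<in>Basis - {\<gamma>}. (v \<bullet> x) *\<^sub>R x)"
        using \<gamma> by (simp add: sum.remove)
      finally have "v - (v \<bullet> \<gamma>) *\<^sub>R \<gamma> = (\<Sum>x\<in>Basis - {\<gamma>}. (v \<bullet> x) *\<^sub>R x)"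
        by (metis add_diff_cancel_left')
      then have "a \<gamma> (i, v) = (- (\<Sum>x\<in>Basis - {\<gamma>}. (v \<bullet> x) *\<^sub>R x), \<beta> i)"
        by (simp only: a_def prod.case)
      also have "\<dots> = - (\<Sum>x\<in>Basis - {\<gamma>}. (v \<bullet> x) *\<^sub>R (x, 0)) + (0, \<beta> i)"
        by (simp add: prod_eq_iff fst_sum snd_sum)
      also have "\<dots> \<in> span ?B"
        using that by (intro span_add span_neg span_sum span_scale span_base) auto
      finally show ?thesis .
    qed
    then have "a \<gamma> ` ?J \<subseteq> span ?B"
      by auto
    then have "dim (a \<gamma> ` ?J) \<le> card ?B"
      by (rule dim_le_card) simp
    also have "\<dots> \<le> card ((\<lambda>x. (x, 0 :: 'a)) ` (Basis - {\<gamma>})) + card ((\<lambda>x. (0 :: 'a, x)) ` \<beta> ` {..<r})"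
      by (rule card_Un_le)
    also have "\<dots> \<le> card (Basis - {\<gamma>}) + card {..<r}"
      unfolding image_image by (intro add_mono card_image_le) auto
    also have "\<dots> = D"
      using \<gamma> r by (simp add: D card_Diff_singleton)
    finally show ?thesis .
  qed
  have pat: "max_pattern r V u \<in> patterns ?J (a \<gamma>) (b \<gamma> \<sigma>)"
    if \<gamma>: "\<gamma> \<in> Basis" and u: "u \<bullet> \<gamma> = \<sigma>" for u \<gamma> \<sigma>
  proof -
    \<comment> \<open>With the heights set to the support values of the \<open>V i\<close>, all
      inequalities hold, with equality exactly at the maximisers of \<open>u\<close>.\<close>
    define h where "h i = Max ((\<bullet>) u ` V i)" for i
    have ne: "V i \<noteq> {}" if "i < r" for i
      using card[OF that] n by auto
    have h: "u \<bullet> v \<le> h i" if "i < r" "v \<in> V i" for i v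
      unfolding h_def using fin that by (intro Max_ge) auto
    have h': "\<exists>w\<in>V i. u \<bullet> w = h i" if "i < r" for i
    proof -
      have "h i \<in> (\<bullet>) u ` V i"
        unfolding h_def using fin ne that by (intro Max_in) auto
      then show ?thesis by auto
    qed
    define y where "y = (u, \<Sum>i<r. h i *\<^sub>R \<beta> i)"
    have in\<beta>: "\<beta> i \<bullet> (\<Sum>j<r. h j *\<^sub>R \<beta> j) = h i" if "i < r" for i
    proof -
      have "\<beta> i \<bullet> (\<Sum>j<r. h j *\<^sub>R \<beta> j) = (\<Sum>j<r. (if j = i then h j else 0))"
        unfolding inner_sum_right
      proof (rule sum.cong)
        fix j assume j: "j \<in> {..<r}"
        have "\<beta> i \<bullet> \<beta> j = (if j = i then 1 else 0)"
          using \<beta> that j by (auto simp: inner_Basis inj_on_def image_subset_iff)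
        then show "\<beta> i \<bullet> h j *\<^sub>R \<beta> j = (if j = i then h j else 0)"
          by simp
      qed simp
      then show ?thesis
        using that by simp
    qed
    have ay: "a \<gamma> (i, v) \<bullet> y - b \<gamma> \<sigma> (i, v) = h i - u \<bullet> v" if "i < r" for i v
      using in\<beta>[OF that] u
      by (simp add: a_def b_def y_def inner_diff_left inner_commute[of u] algebra_simps)
    have "b \<gamma> \<sigma> j \<le> a \<gamma> j \<bullet> y" if j: "j \<in> ?J" for j
    proof -
      obtain i v where iv: "j = (i, v)" "i < r" "v \<in> V i"
        using j by auto
      show ?thesis
        using ay[OF iv(2), of v] h[OF iv(2,3)] iv(1) by simp
    qed
    then have "y \<in> feasible ?J (a \<gamma>) (b \<gamma> \<sigma>)"
      by (simp add: feasible_def)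
    moreover have "tight ?J (a \<gamma>) (b \<gamma> \<sigma>) y = max_pattern r V u"
    proof -
      have "a \<gamma> (i, v) \<bullet> y = b \<gamma> \<sigma> (i, v) \<longleftrightarrow> (\<forall>w\<in>V i. u \<bullet> w \<le> u \<bullet> v)"
        if iv: "i < r" "v \<in> V i" for i v
      proof -
        have "a \<gamma> (i, v) \<bullet> y = b \<gamma> \<sigma> (i, v) \<longleftrightarrow> u \<bullet> v = h i"
          using ay[OF iv(1), of v] by auto
        also have "\<dots> \<longleftrightarrow> (\<forall>w\<in>V i. u \<bullet> w \<le> u \<bullet> v)"
          proof
          assume "u \<bullet> v = h i"
          then show "\<forall>w\<in>V i. u \<bullet> w \<le> u \<bullet> v"
            using h[OF iv(1)] by simp
        next
          assume "\<forall>w\<in>V i. u \<bullet> w \<le> u \<bullet> v"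
          then show "u \<bullet> v = h i"
            using h[OF iv] h'[OF iv(1)] by force
        qed
        finally show ?thesis .
      qed
      then show ?thesis
        by (auto simp: tight_def max_pattern_def)
    qed
    ultimately show ?thesis
      by (auto simp: patterns_def)
  qed
  let ?K = "(Basis :: 'a set) \<times> {1, - 1 :: real}"
  let ?U = "\<Union>(\<gamma>, \<sigma>)\<in>?K. patterns ?J (a \<gamma>) (b \<gamma> \<sigma>)"
  have sub: "range (max_pattern r V) \<subseteq> insert (max_pattern r V 0) ?U"
  proof
    fix Pt assume "Pt \<in> range (max_pattern r V)"
    then obtain u where u: "Pt = max_pattern r V u" by auto
    show "Pt \<in> insert (max_pattern r V 0) ?U"
    proof (cases "u = 0")
      case True
      with u show ?thesis by simp
    next
      case False
      then obtain \<gamma> where \<gamma>: "\<gamma> \<in> Basis" "u \<bullet> \<gamma> \<noteq> 0"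
        using euclidean_all_zero_iff by blast
      define w where "w = (1 / \<bar>u \<bullet> \<gamma>\<bar>) *\<^sub>R u"
      have w: "Pt = max_pattern r V w"
        unfolding w_def u using \<gamma> by (subst max_pattern_scale) auto
      have "w \<bullet> \<gamma> = sgn (u \<bullet> \<gamma>)"
        using \<gamma> by (simp add: w_def sgn_real_def abs_if)
      then have "(\<gamma>, w \<bullet> \<gamma>) \<in> ?K"
        using \<gamma> by (auto simp: sgn_real_def)
      then show ?thesis
        using pat[OF \<gamma>(1) refl, of w] w by blast
    qed
  qed
  have finp: "finite (patterns ?J (a \<gamma>) (b \<gamma> \<sigma>))" for \<gamma> \<sigma>
    by (rule finite_subset[of _ "Pow ?J"]) (use J in \<open>auto simp: patterns_def tight_def\<close>)
  then have finU: "finite (insert (max_pattern r V 0) ?U)"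
    by auto
  show "finite (range (max_pattern r V))"
    using finite_subset[OF sub finU] .
  have "card (range (max_pattern r V)) \<le> card (insert (max_pattern r V 0) ?U)"
    by (rule card_mono[OF finU sub])
  also have "\<dots> \<le> Suc (card ?U)"
    using finU by (simp add: card_insert_if)
  also have "card ?U \<le> (\<Sum>k\<in>?K. card (case k of (\<gamma>, \<sigma>) \<Rightarrow> patterns ?J (a \<gamma>) (b \<gamma> \<sigma>)))"
    by (rule card_UN_le) simp
  also have "\<dots> \<le> (\<Sum>k\<in>?K. 2 ^ Suc D * Suc (D div 2) * (r * n) ^ (D div 2))"
  proof (rule sum_mono)
    fix k assume "k \<in> ?K"
    then obtain \<gamma> \<sigma> where k: "k = (\<gamma>, \<sigma>)" "\<gamma> \<in> Basis"
      by auto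
    show "card (case k of (\<gamma>, \<sigma>) \<Rightarrow> patterns ?J (a \<gamma>) (b \<gamma> \<sigma>)) \<le> 2 ^ Suc D * Suc (D div 2) * (r * n) ^ (D div 2)"
      unfolding k prod.case cJ[symmetric] by (rule card_patterns_le[OF J J0 dim[OF k(2)]])
  qed
  also have "\<dots> = 2 * DIM('a) * (2 ^ Suc D * Suc (D div 2) * (r * n) ^ (D div 2))"
    by (simp add: card_cartesian_product)
  finally show "card (range (max_pattern r V)) \<le>
      Suc (2 * DIM('a) * (2 ^ Suc D * Suc (D div 2) * (r * n) ^ (D div 2)))"
    by simp
qed

text \<open>The summand 2 accounts for the empty face and for the zero functional.\<close>

theorem max_sum_complexity_le:
  assumes n: "DIM('a::euclidean_space) < n" and d: "2 \<le> DIM('a)" and r: "0 < r" "r \<le> DIM('a)"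
    and D: "D = DIM('a) + r - 1"
  shows "max_sum_complexity TYPE('a) r n \<le>
      2 + 2 * DIM('a) * (2 ^ Suc D * Suc (D div 2) * (r * n) ^ (D div 2))"
proof -
  have "complexity (\<Sum>i<r. P i) \<le> 2 + 2 * DIM('a) * (2 ^ Suc D * Suc (D div 2) * (r * n) ^ (D div 2))"
    if P: "\<forall>i<r. P i \<in> n_vertex_polytopes DIM('a) n" for P :: "nat \<Rightarrow> 'a set"
  proof -
    let ?V = "\<lambda>i. vertices (P i)"
    have V: "finite (?V i)" "card (?V i) = n" if "i < r" for i
      using P that by (auto simp: n_vertex_polytopes_def)
    have "P i = convex hull (?V i)" if "i < r" for i
      using P that Krein_Milman_Minkowski polytope_imp_compact polytope_imp_convex
      unfolding n_vertex_polytopes_def vertices_def by blast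
    then have "(\<Sum>i<r. P i) = (\<Sum>i<r. convex hull (?V i))"
      by (intro sum.cong) auto
    moreover have n0: "0 < n"
      using n by simp
    note pat = card_max_patterns_le[of r ?V n D, OF V n0 r D]
    have "complexity (\<Sum>i<r. convex hull (?V i)) \<le> Suc (card (range (max_pattern r ?V)))"
      using V(1) pat(1) by (rule complexity_sum_le)
    ultimately show ?thesis
      using pat(2) by simp
  qed
  then have "\<forall>c\<in>sum_complexities TYPE('a) r n.
      c \<le> 2 + 2 * DIM('a) * (2 ^ Suc D * Suc (D div 2) * (r * n) ^ (D div 2))"
    unfolding sum_complexities_def by blast
  then show ?thesis
    unfolding max_sum_complexity_def
    using Max_in[OF finite_sum_complexities sum_complexities_nonempty[OF d n]] by blast
qed

section \<open>Polytopes on curves\<close>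

lemma extreme_point_of_hullI:
  fixes V :: "'a::euclidean_space set"
  assumes "finite V" "v \<in> V" "\<And>w. w \<in> V \<Longrightarrow> w \<noteq> v \<Longrightarrow> u \<bullet> w < u \<bullet> v"
  shows "v extreme_point_of convex hull V"
proof -
  have "convex hull (V - {v}) \<subseteq> {x. u \<bullet> x < u \<bullet> v}"
    using assms(3) by (intro hull_minimal convex_halfspace_lt) auto
  then have "v extreme_point_of convex hull (insert v (V - {v}))"
    using assms(1) by (intro extreme_point_of_convex_hull_insert) auto
  then show ?thesis
    using assms(2) by (simp add: insert_absorb)
qed

lemma finite_real_bound:
  assumes "finite X"
  obtains M :: real where "0 < M" "\<And>x. x \<in> X \<Longrightarrow> f x < M"
proof -
  have "f x < 1 + (\<Sum>x\<in>X. \<bar>f x\<bar>)" if "x \<in> X" for x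
    using member_le_sum[OF that, of "\<lambda>x. \<bar>f x\<bar>"] assms by (simp add: abs_le_D1)
  moreover have "0 < 1 + (\<Sum>x\<in>X. \<bar>f x\<bar>)"
    by (simp add: add_pos_nonneg sum_nonneg)
  ultimately show ?thesis
    using that by blast
qed

text \<open>Coordinates are numbered from 0: the vector \<open>\<beta> (2 * k - 1)\<close> carries \<open>t ^ (2 * k)\<close> on the first
  curve and the squares on all others. Since \<open>p\<^sup>2\<close> is monic of degree \<open>2 * k\<close>, the functional
  \<open>touching p s\<close> is \<open>- 1\<close> there, as the parabolas need.\<close>

locale ordered_basis =
  fixes \<beta> :: "nat \<Rightarrow> 'a::euclidean_space" and k r :: nat
  assumes bij: "bij_betw \<beta> {..<DIM('a)} Basis"
    and k: "0 < k" and r: "0 < r" and le: "2 * k + r - 1 \<le> DIM('a)"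
begin

definition point :: "(nat \<Rightarrow> real) \<Rightarrow> 'a"
  where "point c = (\<Sum>j<DIM('a). c j *\<^sub>R \<beta> j)"

definition curve :: "nat \<Rightarrow> real \<Rightarrow> 'a"
  where "curve i t = (if i = 0 then point (\<lambda>j. if j < 2 * k then t ^ Suc j else 0)
    else point (\<lambda>j. if j = 2 * k - 1 + i then t else if j = 2 * k - 1 then t\<^sup>2 else 0))"

text \<open>The index \<open>Suc j\<close> matches the curve, which starts with the first power. The
  coordinate \<open>2 * k - 1 + i\<close> receives \<open>2 * s i\<close>; for
  \<open>i \<ge> r\<close> all curves vanish there, so an arbitrary value of \<open>s i\<close>
  affects only the apex points.\<close>

definition touching :: "real poly \<Rightarrow> (nat \<Rightarrow> real) \<Rightarrow> 'a"
  where "touching p s = point (\<lambda>j. if j < 2 * k then - coeff (p\<^sup>2) (Suc j) else 2 * s (j - (2 * k - 1)))"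

text \<open>The vertices of a simplex of dimension \<open>DIM('a) - 1\<close> in the hyperplane at
  height \<open>M\<close> along \<open>\<beta> (2 * k - 1)\<close>, the direction in which all
  touching functionals descend.\<close>

definition apex :: "real \<Rightarrow> nat \<Rightarrow> 'a"
  where "apex M j = M *\<^sub>R \<beta> (2 * k - 1) + (if j = 2 * k - 1 then 0 else \<beta> j)"

definition verts :: "real \<Rightarrow> real set \<Rightarrow> nat \<Rightarrow> 'a set"
  where "verts M T i = curve i ` T \<union> apex M ` {..<DIM('a)}"

lemma k_less: "2 * k - 1 < DIM('a)"
  using k r le by linarith

lemma inner_\<beta>: "i < DIM('a) \<Longrightarrow> j < DIM('a) \<Longrightarrow> \<beta> i \<bullet> \<beta> j = (if i = j then 1 else 0)"
  using bij bij_betwE[OF bij]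
  by (auto simp: bij_betw_def inner_Basis dest: inj_onD)

lemma point_inner_\<beta>: "j < DIM('a) \<Longrightarrow> point c \<bullet> \<beta> j = c j"
proof -
  assume j: "j < DIM('a)"
  have "point c \<bullet> \<beta> j = (\<Sum>i<DIM('a). if i = j then c i else 0)"
    unfolding point_def inner_sum_left using j by (intro sum.cong) (auto simp: inner_\<beta>)
  then show ?thesis
    using j by simp
qed

lemma inner_point: "x \<bullet> point c = (\<Sum>j<DIM('a). (x \<bullet> \<beta> j) * c j)"
  by (simp add: point_def inner_sum_right mult.commute)

lemma eq_zeroI: "(\<And>j. j < DIM('a) \<Longrightarrow> x \<bullet> \<beta> j = 0) \<Longrightarrow> x = 0"
  using bij by (metis bij_betw_imp_surj_on euclidean_all_zero_iff imageE lessThan_iff)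

lemma touching_\<beta>: "j < 2 * k \<Longrightarrow> touching p s \<bullet> \<beta> j = - coeff (p\<^sup>2) (Suc j)"
  using k_less by (simp add: touching_def point_inner_\<beta>)

lemma touching_top:
  assumes "lead_coeff p = 1" "degree p = k"
  shows "touching p s \<bullet> \<beta> (2 * k - 1) = - 1"
proof -
  have "degree (p\<^sup>2) = 2 * k"
    using assms by (subst degree_power_eq) auto
  then have "coeff (p\<^sup>2) (2 * k) = 1"
    using lead_coeff_power[of p 2] assms by simp
  then show ?thesis
    using k by (simp add: touching_\<beta>)
qed

text \<open>The curve has no coordinate for the constant term, hence the offset
  \<open>(poly p 0)\<^sup>2\<close>. The value is largest exactly at the roots of
  \<open>p\<close>.\<close>

lemma touching_curve_0:
  assumes "degree p = k"
  shows "touching p s \<bullet> curve 0 t = (poly p 0)\<^sup>2 - (poly p t)\<^sup>2"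
proof -
  have deg: "degree (p\<^sup>2) \<le> 2 * k"
    using degree_power_le[of p 2] assms by simp
  have "touching p s \<bullet> curve 0 t = (\<Sum>j<DIM('a). (touching p s \<bullet> \<beta> j) * (if j < 2 * k then t ^ Suc j else 0))"
    by (simp only: curve_def inner_point if_True simp_thms)
  also have "\<dots> = (\<Sum>j<2 * k. (touching p s \<bullet> \<beta> j) * (if j < 2 * k then t ^ Suc j else 0))"
    using k_less by (intro sum.mono_neutral_right) auto
  also have "\<dots> = - (\<Sum>j<2 * k. coeff (p\<^sup>2) (Suc j) * t ^ Suc j)"
    by (simp add: touching_\<beta> sum_negf[symmetric])
  also have "(\<Sum>j<2 * k. coeff (p\<^sup>2) (Suc j) * t ^ Suc j) = (\<Sum>j\<le>2 * k. coeff (p\<^sup>2) j * t ^ j) - coeff (p\<^sup>2) 0"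
    by (simp add: sum.atMost_shift)
  also have "(\<Sum>j\<le>2 * k. coeff (p\<^sup>2) j * t ^ j) = poly (p\<^sup>2) t"
    unfolding poly_altdef using deg by (intro sum.mono_neutral_right) (auto simp: coeff_eq_0)
  also have "coeff (p\<^sup>2) 0 = poly (p\<^sup>2) 0"
    by (rule poly_0_coeff_0[symmetric])
  finally show ?thesis
    by simp
qed

text \<open>Completing the square in \<open>2 * s i * t - t\<^sup>2\<close>; the maximum is at
  \<open>t = s i\<close> only.\<close>

lemma touching_curve:
  assumes "lead_coeff p = 1" "degree p = k" "0 < i" "i < r"
  shows "touching p s \<bullet> curve i t = (s i)\<^sup>2 - (t - s i)\<^sup>2"
proof -
  let ?i = "2 * k - 1 + i"
  have i: "?i < DIM('a)" "\<not> ?i < 2 * k" "?i \<noteq> 2 * k - 1"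
    using assms(3,4) k le by linarith+
  have "touching p s \<bullet> curve i t =
      (\<Sum>j<DIM('a). (touching p s \<bullet> \<beta> j) * (if j = ?i then t else if j = 2 * k - 1 then t\<^sup>2 else 0))"
    unfolding curve_def using less_imp_neq[OF assms(3), symmetric] by (simp only: inner_point if_False)
  also have "\<dots> = (\<Sum>j\<in>{?i, 2 * k - 1}. (touching p s \<bullet> \<beta> j) * (if j = ?i then t else if j = 2 * k - 1 then t\<^sup>2 else 0))"
    using i k_less by (intro sum.mono_neutral_right) auto
  also have "\<dots> = (touching p s \<bullet> \<beta> ?i) * t + (touching p s \<bullet> \<beta> (2 * k - 1)) * t\<^sup>2"
    using i(3) by simp
  also have "touching p s \<bullet> \<beta> (2 * k - 1) = - 1"
    by (rule touching_top) (fact assms)+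
  also have "touching p s \<bullet> \<beta> ?i = 2 * s i"
    unfolding touching_def point_inner_\<beta>[OF i(1)] using i(2) by simp
  finally show ?thesis
    by (simp add: power2_eq_square algebra_simps)
qed

lemma inj_curve:
  assumes "i < r"
  shows "inj (curve i)"
proof (cases "i = 0")
  case True
  have "curve i t \<bullet> \<beta> 0 = t" for t
    using True k k_less by (simp add: curve_def point_inner_\<beta>)
  then show ?thesis
    by (metis injI)
next
  case False
  have "2 * k - 1 + i < DIM('a)"
    using assms k le by linarith
  then have "curve i t \<bullet> \<beta> (2 * k - 1 + i) = t" for t
    using False by (simp add: curve_def point_inner_\<beta>)
  then show ?thesis
    by (metis injI)
qed

lemma inner_apex:
  "x \<bullet> apex M j = M * (x \<bullet> \<beta> (2 * k - 1)) + (if j = 2 * k - 1 then 0 else x \<bullet> \<beta> j)"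
  by (simp add: apex_def inner_add_right)

lemma apex_top: "j < DIM('a) \<Longrightarrow> \<beta> (2 * k - 1) \<bullet> apex M j = M"
  using k_less by (simp add: inner_apex inner_\<beta>)

lemma inj_apex: "inj_on (apex M) {..<DIM('a)}"
proof (rule inj_onI)
  fix i j assume ij: "i \<in> {..<DIM('a)}" "j \<in> {..<DIM('a)}" "apex M i = apex M j"
  show "i = j"
  proof (rule ccontr)
    assume ne: "i \<noteq> j"
    have "\<beta> i \<bullet> apex M i = \<beta> i \<bullet> apex M j" "\<beta> j \<bullet> apex M i = \<beta> j \<bullet> apex M j"
      using ij(3) by simp_all
    then show False
      using ij(1,2) ne k_less by (auto simp: inner_apex inner_\<beta> split: if_splits)
  qed
qed

lemma apex_not_curve:
  assumes "\<And>t. t \<in> T \<Longrightarrow> \<beta> (2 * k - 1) \<bullet> curve i t < M"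
  shows "curve i ` T \<inter> apex M ` {..<DIM('a)} = {}"
  using assms apex_top by fastforce

lemma card_verts:
  assumes "i < r" "finite T" "\<And>t. t \<in> T \<Longrightarrow> \<beta> (2 * k - 1) \<bullet> curve i t < M"
  shows "card (verts M T i) = card T + DIM('a)"
proof -
  have "card (verts M T i) = card (curve i ` T) + card (apex M ` {..<DIM('a)})"
    unfolding verts_def using assms apex_not_curve[OF assms(3)] by (intro card_Un_disjoint) auto
  also have "\<dots> = card T + DIM('a)"
    using inj_curve[OF assms(1)] inj_apex by (simp add: card_image inj_on_subset)
  finally show ?thesis .
qed

section \<open>Dimension and apex vertices of the summands\<close>

text \<open>A hyperplane through all apex points must have its normal along
  \<open>\<beta> (2 * k - 1)\<close>, so it is the one at height \<open>M\<close>; the curve points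
  lie strictly below it.\<close>

lemma aff_dim_verts:
  assumes "T \<noteq> {}" "\<And>t. t \<in> T \<Longrightarrow> \<beta> (2 * k - 1) \<bullet> curve i t < M"
  shows "aff_dim (verts M T i) = DIM('a)"
proof (rule ccontr)
  let ?b = "2 * k - 1"
  assume "aff_dim (verts M T i) \<noteq> DIM('a)"
  then have "aff_dim (verts M T i) < DIM('a)"
    using aff_dim_le_DIM[of "verts M T i"] by linarith
  then obtain a c where a: "a \<noteq> 0" "verts M T i \<subseteq> {x. a \<bullet> x = c}"
    by (rule aff_lowdim_subset_hyperplane)
  have ap: "a \<bullet> apex M j = c" if "j < DIM('a)" for j
    using a(2) that by (auto simp: verts_def)
  from ap[OF k_less] have c: "c = M * (a \<bullet> \<beta> ?b)"
    by (simp add: inner_apex)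
  have 0: "a \<bullet> \<beta> j = 0" if "j < DIM('a)" "j \<noteq> ?b" for j
    using ap[OF that(1)] that(2) c by (simp add: inner_apex)
  obtain t where t: "t \<in> T"
    using assms(1) by auto
  define x where "x = curve i t"
  have "a \<bullet> x = c"
    using a(2) t by (auto simp: verts_def x_def)
  have "x = point (\<lambda>j. x \<bullet> \<beta> j)"
    using eq_zeroI[of "x - point (\<lambda>j. x \<bullet> \<beta> j)"] by (simp add: inner_diff_left point_inner_\<beta>)
  then have "a \<bullet> x = (\<Sum>j<DIM('a). (a \<bullet> \<beta> j) * (x \<bullet> \<beta> j))"
    using inner_point by metis
  also have "\<dots> = (\<Sum>j\<in>{?b}. (a \<bullet> \<beta> j) * (x \<bullet> \<beta> j))"
    using 0 k_less by (intro sum.mono_neutral_right) auto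
  finally have "(a \<bullet> \<beta> ?b) * (x \<bullet> \<beta> ?b - M) = 0"
    using \<open>a \<bullet> x = c\<close> c by (auto simp: algebra_simps)
  then have "a \<bullet> \<beta> ?b = 0"
    using assms(2)[OF t] by (auto simp: x_def inner_commute)
  then have "a = 0"
    using 0 by (metis eq_zeroI)
  then show False
    using a(1) by simp
qed

lemma apex_extreme:
  assumes "finite T" "j < DIM('a)" "\<And>t. t \<in> T \<Longrightarrow> \<beta> (2 * k - 1) \<bullet> curve i t < M"
  shows "apex M j extreme_point_of convex hull (verts M T i)"
proof -
  let ?b = "2 * k - 1"
  \<comment> \<open>\<open>w\<close> singles out \<open>apex M j\<close> among the apex points;
    adding a large multiple of the height direction then beats the curve points as well.\<close>
  define w where "w = (if j = ?b then - (\<Sum>l\<in>{..<DIM('a)} - {?b}. \<beta> l) else \<beta> j)"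
  have w: "w \<bullet> apex M l < w \<bullet> apex M j" if l: "l < DIM('a)" "l \<noteq> j" for l
  proof (cases "j = ?b")
    case True
    have "w \<bullet> \<beta> m = (if m = ?b then 0 else - 1)" if "m < DIM('a)" for m
    proof -
      have "w \<bullet> \<beta> m = - (\<Sum>l\<in>{..<DIM('a)} - {?b}. if l = m then 1 else 0)"
        unfolding w_def using True that by (simp add: inner_sum_left inner_\<beta>)
      then show ?thesis
        using that by (simp add: sum.delta')
    qed
    then show ?thesis
      using True l k_less by (simp add: inner_apex)
  next
    case False
    then show ?thesis
      using assms(2) l k_less by (simp add: w_def inner_apex inner_\<beta>)
  qed
  \<comment> \<open>Each curve point falls short in height by a positive amount, so \<open>L\<close>
    only has to exceed finitely many quotients of the advantage in \<open>w\<close> by that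
    amount.\<close>
  obtain L where L: "0 < L"
    "\<And>t. t \<in> T \<Longrightarrow> (w \<bullet> curve i t - w \<bullet> apex M j) / (M - \<beta> ?b \<bullet> curve i t) < L"
    using finite_real_bound[OF assms(1), of "\<lambda>t. (w \<bullet> curve i t - w \<bullet> apex M j) / (M - \<beta> ?b \<bullet> curve i t)"]
    by blast
  have "(L *\<^sub>R \<beta> ?b + w) \<bullet> x < (L *\<^sub>R \<beta> ?b + w) \<bullet> apex M j"
    if x: "x \<in> verts M T i" "x \<noteq> apex M j" for x
    using x(1) unfolding verts_def
  proof
    assume "x \<in> curve i ` T"
    then obtain t where t: "t \<in> T" "x = curve i t"
      by auto
    then have "w \<bullet> x - w \<bullet> apex M j < L * (M - \<beta> ?b \<bullet> x)"
      using L(2)[OF t(1)] assms(3)[OF t(1)] by (simp add: pos_divide_less_eq)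
    then show ?thesis
      using apex_top[OF assms(2)] by (simp add: inner_add_left algebra_simps)
  next
    assume "x \<in> apex M ` {..<DIM('a)}"
    then obtain l where "l < DIM('a)" "x = apex M l"
      by auto
    moreover from this have "l \<noteq> j"
      using x(2) by auto
    ultimately show ?thesis
      using w apex_top assms(2) by (simp add: inner_add_left)
  qed
  then show ?thesis
    using assms(1,2) by (intro extreme_point_of_hullI[of _ _ "L *\<^sub>R \<beta> ?b + w"]) (auto simp: verts_def)
qed

section \<open>Maximisers of the touching functionals\<close>

text \<open>The height contributes \<open>- M\<close>, which outweighs the one remaining coordinate.
  The maxima on the curves are squares, so apex points never compete.\<close>

lemma touching_apex_neg:
  assumes "lead_coeff p = 1" "degree p = k" "0 < M" "j < DIM('a)" "touching p s \<bullet> \<beta> j < M"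
  shows "touching p s \<bullet> apex M j < 0"
  using assms(3,5) touching_top[OF assms(1,2)] by (simp add: inner_apex)

text \<open>A root of \<open>p\<close> in \<open>T\<close> ensures that the bound
  \<open>(poly p 0)\<^sup>2\<close> is attained, so that the maximisers are exactly the points with
  this value.\<close>

lemma max_pattern_touching_0:
  assumes p: "lead_coeff p = 1" "degree p = k" and M: "0 < M"
    "\<And>j. j < DIM('a) \<Longrightarrow> touching p s \<bullet> \<beta> j < M"
    and root: "z \<in> T" "poly p z = 0"
  shows "(0, v) \<in> max_pattern r (verts M T) (touching p s) \<longleftrightarrow> v \<in> curve 0 ` {t \<in> T. poly p t = 0}"
proof -
  let ?u = "touching p s"
  have le: "?u \<bullet> w \<le> (poly p 0)\<^sup>2" and eq: "?u \<bullet> w = (poly p 0)\<^sup>2 \<longleftrightarrow> w \<in> curve 0 ` {t \<in> T. poly p t = 0}"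
    if w: "w \<in> verts M T 0" for w
  proof -
    have "?u \<bullet> w \<le> (poly p 0)\<^sup>2 \<and> (?u \<bullet> w = (poly p 0)\<^sup>2 \<longleftrightarrow> w \<in> curve 0 ` {t \<in> T. poly p t = 0})"
      using w unfolding verts_def
    proof
      assume "w \<in> curve 0 ` T"
      then obtain t where "t \<in> T" "w = curve 0 t"
        by auto
      then show ?thesis
        using inj_curve[OF r] by (auto simp: touching_curve_0[OF p(2)] dest: injD)
    next
      assume "w \<in> apex M ` {..<DIM('a)}"
      then have "?u \<bullet> w < 0"
        using touching_apex_neg[OF p M(1) _ M(2)] by auto
      moreover have "?u \<bullet> curve 0 t = (poly p 0)\<^sup>2" if "poly p t = 0" for t
        using that by (simp add: touching_curve_0[OF p(2)])
      moreover have "0 \<le> (poly p 0)\<^sup>2"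
        by simp
      ultimately show ?thesis
        by (smt (verit, best) imageE mem_Collect_eq)
    qed
    then show "?u \<bullet> w \<le> (poly p 0)\<^sup>2" "?u \<bullet> w = (poly p 0)\<^sup>2 \<longleftrightarrow> w \<in> curve 0 ` {t \<in> T. poly p t = 0}"
      by auto
  qed
  have z: "curve 0 z \<in> verts M T 0" "?u \<bullet> curve 0 z = (poly p 0)\<^sup>2"
    using root by (auto simp: verts_def touching_curve_0[OF p(2)])
  have "(0, v) \<in> max_pattern r (verts M T) ?u \<longleftrightarrow> v \<in> verts M T 0 \<and> ?u \<bullet> v = (poly p 0)\<^sup>2"
  proof
    assume "(0, v) \<in> max_pattern r (verts M T) ?u"
    then have v: "v \<in> verts M T 0" "\<And>w. w \<in> verts M T 0 \<Longrightarrow> ?u \<bullet> w \<le> ?u \<bullet> v"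
      by (auto simp: max_pattern_def)
    show "v \<in> verts M T 0 \<and> ?u \<bullet> v = (poly p 0)\<^sup>2"
      using v(1) v(2)[OF z(1)] z(2) le[OF v(1)] by simp
  next
    assume "v \<in> verts M T 0 \<and> ?u \<bullet> v = (poly p 0)\<^sup>2"
    then show "(0, v) \<in> max_pattern r (verts M T) ?u"
      using r le by (simp add: max_pattern_def)
  qed
  also have "\<dots> \<longleftrightarrow> v \<in> curve 0 ` {t \<in> T. poly p t = 0}"
    using eq by (auto simp: verts_def)
  finally show ?thesis .
qed

lemma max_pattern_touching:
  assumes p: "lead_coeff p = 1" "degree p = k" and M: "0 < M"
    "\<And>j. j < DIM('a) \<Longrightarrow> touching p s \<bullet> \<beta> j < M"
    and i: "0 < i" "i < r" and s: "s i \<in> T"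
  shows "(i, v) \<in> max_pattern r (verts M T) (touching p s) \<longleftrightarrow> v = curve i (s i)"
proof -
  let ?u = "touching p s"
  have s': "curve i (s i) \<in> verts M T i" "?u \<bullet> curve i (s i) = (s i)\<^sup>2"
    using s by (auto simp: verts_def touching_curve[OF p i])
  have lt: "?u \<bullet> w < (s i)\<^sup>2" if w: "w \<in> verts M T i" "w \<noteq> curve i (s i)" for w
    using w(1) unfolding verts_def
  proof
    assume "w \<in> curve i ` T"
    then show ?thesis
      using w(2) by (auto simp: touching_curve[OF p i])
  next
    assume "w \<in> apex M ` {..<DIM('a)}"
    then have "?u \<bullet> w < 0"
      using touching_apex_neg[OF p M(1) _ M(2)] by auto
    moreover have "0 \<le> (s i)\<^sup>2"
      by simp
    ultimately show ?thesis
      by linarith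
  qed
  show ?thesis
  proof
    assume "(i, v) \<in> max_pattern r (verts M T) ?u"
    then have v: "v \<in> verts M T i" "?u \<bullet> curve i (s i) \<le> ?u \<bullet> v"
      using s'(1) by (auto simp: max_pattern_def)
    show "v = curve i (s i)"
      using lt[OF v(1)] v(2) s'(2) by fastforce
  next
    assume v: "v = curve i (s i)"
    have "?u \<bullet> w \<le> ?u \<bullet> v" if "w \<in> verts M T i" for w
      using lt[OF that] s'(2) v by fastforce
    then show "(i, v) \<in> max_pattern r (verts M T) ?u"
      using i(2) s'(1) v by (simp add: max_pattern_def)
  qed
qed

lemma max_pattern_extreme:
  assumes "finite (V i)" "\<And>w. (i, w) \<in> max_pattern r V u \<longleftrightarrow> w = v"
  shows "v extreme_point_of convex hull (V i)"
proof (rule extreme_point_of_hullI[of _ _ u])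
  have v: "v \<in> V i" "i < r" "\<And>w. w \<in> V i \<Longrightarrow> u \<bullet> w \<le> u \<bullet> v"
    using assms(2)[of v] by (auto simp: max_pattern_def)
  show "v \<in> V i" "finite (V i)" by fact+
  fix w assume w: "w \<in> V i" "w \<noteq> v"
  have "u \<bullet> w \<noteq> u \<bullet> v"
  proof
    assume "u \<bullet> w = u \<bullet> v"
    then have "(i, w) \<in> max_pattern r V u"
      using v w(1) by (auto simp: max_pattern_def)
    then show False
      using assms(2) w(2) by auto
  qed
  then show "u \<bullet> w < u \<bullet> v"
    using v(3)[OF w(1)] by simp
qed

section \<open>The lower bound construction\<close>

theorem sum_complexity_ge:
  assumes N: "0 < N"
  shows "\<exists>V. (\<forall>i<r. convex hull (V i) \<in> n_vertex_polytopes DIM('a) (N + DIM('a))) \<and>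
    (N choose k) * N ^ (r - 1) \<le> complexity (\<Sum>i<r. convex hull (V i) :: 'a set)"
proof -
  let ?b = "2 * k - 1"
  define T where "T = real ` {..<N}"
  have T: "finite T" "card T = N" "T \<noteq> {}"
    using N by (auto simp: T_def card_image)
  define sp where "sp S = (\<Prod>t\<in>S. [:- t, 1:])" for S :: "real set"
  have sp: "lead_coeff (sp S) = 1" "degree (sp S) = card S" for S
  proof -
    show "lead_coeff (sp S) = 1"
      by (simp only: sp_def lead_coeff_prod) simp
    show "degree (sp S) = card S"
      by (simp add: sp_def degree_prod_eq_sum_degree)
  qed
  have sp0: "poly (sp S) t = 0 \<longleftrightarrow> t \<in> S" if "S \<subseteq> T" for S t
    using finite_subset[OF that T(1)] by (auto simp: sp_def poly_prod)
  let ?\<S> = "{S. S \<subseteq> T \<and> card S = k}" and ?F = "PiE {1..<r} (\<lambda>_. T)"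
  \<comment> \<open>The products over \<open>k\<close>-element sets \<open>S\<close> produce the
    counted faces. The powers \<open>[:- t, 1:] ^ k\<close> have a single root and serve to show
    that each curve point is a vertex.\<close>
  let ?\<P> = "sp ` ?\<S> \<union> (\<lambda>t. [:- t, 1:] ^ k) ` T"
  have \<P>: "lead_coeff p = 1 \<and> degree p = k" if "p \<in> ?\<P>" for p
    using that
  proof
    assume "p \<in> sp ` ?\<S>"
    then show ?thesis
      using sp by auto
  next
    assume "p \<in> (\<lambda>t. [:- t, 1:] ^ k) ` T"
    then obtain t where p: "p = [:- t, 1:] ^ k"
      by auto
    have "lead_coeff p = 1"
      unfolding p lead_coeff_power by simp
    then show ?thesis
      by (simp add: p degree_power_eq)
  qed
  have fin\<S>: "finite ?\<S>" and finF: "finite ?F"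
    using T by (auto intro: finite_PiE)
  \<comment> \<open>Only finitely many functionals and curve points occur, so one height
    \<open>M\<close> serves all of them.\<close>
  have "finite ((?\<P> \<times> ?F) \<times> {..<DIM('a)})"
    using fin\<S> T finF by auto
  from finite_real_bound[OF this, of "\<lambda>((p, s), j). touching p s \<bullet> \<beta> j"]
  obtain M1 where M1: "0 < M1"
    "\<And>p s j. p \<in> ?\<P> \<Longrightarrow> s \<in> ?F \<Longrightarrow> j < DIM('a) \<Longrightarrow> touching p s \<bullet> \<beta> j < M1"
    by (smt (verit) SigmaI case_prod_conv lessThan_iff)
  have "finite ({..<r} \<times> T)"
    using T by auto
  from finite_real_bound[OF this, of "\<lambda>(i, t). \<beta> ?b \<bullet> curve i t"]
  obtain M2 where M2: "\<And>i t. i < r \<Longrightarrow> t \<in> T \<Longrightarrow> \<beta> ?b \<bullet> curve i t < M2"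
    by (smt (verit) SigmaI case_prod_conv lessThan_iff)
  define M where "M = max M1 M2"
  have M: "0 < M"
    "\<And>p s j. p \<in> ?\<P> \<Longrightarrow> s \<in> ?F \<Longrightarrow> j < DIM('a) \<Longrightarrow> touching p s \<bullet> \<beta> j < M"
    "\<And>i t. i < r \<Longrightarrow> t \<in> T \<Longrightarrow> \<beta> ?b \<bullet> curve i t < M"
    using M1 M2 by (auto simp: M_def less_max_iff_disj)
  let ?V = "verts M T"
  have finV: "finite (?V i)" for i
    using T by (simp add: verts_def)
  have pat0: "(0, v) \<in> max_pattern r ?V (touching p s) \<longleftrightarrow> v \<in> curve 0 ` {t \<in> T. poly p t = 0}"
    if "p \<in> ?\<P>" "s \<in> ?F" "z \<in> T" "poly p z = 0" for p s z v
    using \<P>[OF that(1)] M(1) M(2)[OF that(1,2)] that(3,4) by (intro max_pattern_touching_0) auto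
  have pat: "(i, v) \<in> max_pattern r ?V (touching p s) \<longleftrightarrow> v = curve i (s i)"
    if "p \<in> ?\<P>" "s \<in> ?F" "0 < i" "i < r" for p s i v
    using \<P>[OF that(1)] M(1) M(2)[OF that(1,2)] that(2-4) by (intro max_pattern_touching) auto
  have ext: "v extreme_point_of convex hull (?V i)" if i: "i < r" and v: "v \<in> ?V i" for i v
    using v unfolding verts_def
  proof
    assume "v \<in> apex M ` {..<DIM('a)}"
    then show "v extreme_point_of convex hull (curve i ` T \<union> apex M ` {..<DIM('a)})"
      using apex_extreme[OF T(1) _ M(3)[OF i]] by (auto simp: verts_def)
  next
    assume "v \<in> curve i ` T"
    then obtain t where t: "t \<in> T" "v = curve i t"
      by auto
    \<comment> \<open>With this \<open>p\<close> and constant \<open>s\<close>, the functional is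
      maximal over \<open>?V i\<close> at parameter \<open>t\<close> alone, whichever
      \<open>i\<close> is considered.\<close>
    define p where "p = [:- t, 1:] ^ k"
    define s where "s = restrict (\<lambda>_. t) {1..<r}"
    have ps: "p \<in> ?\<P>" "s \<in> ?F"
      using t(1) by (auto simp: p_def s_def)
    have p0: "poly p z = 0 \<longleftrightarrow> z = t" for z
      using k by (auto simp: p_def poly_power)
    have "(i, w) \<in> max_pattern r ?V (touching p s) \<longleftrightarrow> w = v" for w
    proof (cases "i = 0")
      case True
      have "{z \<in> T. poly p z = 0} = {t}"
        using p0 t(1) by auto
      then show ?thesis
        using pat0[OF ps t(1)] p0 t(2) True by simp
    next
      case False
      then show ?thesis
        using pat[OF ps _ i] i t(2) by (simp add: s_def)
    qed
    from max_pattern_extreme[of ?V, OF finV this]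
    show "v extreme_point_of convex hull (curve i ` T \<union> apex M ` {..<DIM('a)})"
      by (simp add: verts_def)
  qed
  have "convex hull (?V i) \<in> n_vertex_polytopes DIM('a) (N + DIM('a))" if i: "i < r" for i
  proof -
    have vert: "vertices (convex hull (?V i)) = ?V i"
      using ext[OF i] extreme_point_of_convex_hull by (auto simp: vertices_def)
    have "aff_dim (convex hull (?V i)) = DIM('a)"
      using aff_dim_verts[OF T(3) M(3)[OF i]] by (simp add: aff_dim_convex_hull)
    moreover have "card (?V i) = N + DIM('a)"
      using card_verts[OF i T(1) M(3)[OF i]] T(2) by simp
    moreover have "polytope (convex hull (?V i))"
      using finV by (auto simp: polytope_def)
    ultimately show ?thesis
      using vert finV by (simp add: n_vertex_polytopes_def)
  qed
  moreover have "(N choose k) * N ^ (r - 1) \<le> complexity (\<Sum>i<r. convex hull (?V i))"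
  proof -
    define f where "f = (\<lambda>(S, s). touching (sp S) s)"
    \<comment> \<open>The pattern returns \<open>S\<close> from the maximisers with index 0 and each
      \<open>s i\<close> from the maximiser with index \<open>i\<close>.\<close>
    have inj: "inj_on (max_pattern r ?V \<circ> f) (?\<S> \<times> ?F)"
    proof (rule inj_onI)
      fix x y
      assume xy: "x \<in> ?\<S> \<times> ?F" "y \<in> ?\<S> \<times> ?F"
        and "(max_pattern r ?V \<circ> f) x = (max_pattern r ?V \<circ> f) y"
      moreover obtain S s S' s' where eqs: "x = (S, s)" "y = (S', s')"
        by (cases x, cases y)
      ultimately have S: "S \<subseteq> T" "card S = k" and S': "S' \<subseteq> T" "card S' = k"
        and s: "s \<in> ?F" "s' \<in> ?F"
        and eq: "max_pattern r ?V (touching (sp S) s) = max_pattern r ?V (touching (sp S') s')"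
        by (auto simp: f_def)
      have mem: "sp S \<in> ?\<P>" "sp S' \<in> ?\<P>"
        using S S' by auto
      have c0: "(0, v) \<in> max_pattern r ?V (touching (sp S) s) \<longleftrightarrow> v \<in> curve 0 ` S"
        if S: "S \<subseteq> T" "card S = k" and s: "s \<in> ?F" for S s v
      proof -
        obtain z where z: "z \<in> S"
          using S(2) k by fastforce
        have "{t \<in> T. poly (sp S) t = 0} = S"
          using sp0[OF S(1)] S(1) by auto
        then show ?thesis
          using pat0[of "sp S" s z v] S s z sp0[OF S(1)] by auto
      qed
      have "curve 0 ` S = curve 0 ` S'"
        using c0[OF S s(1)] c0[OF S' s(2)] eq by blast
      then have "S = S'"
        using inj_curve[OF r] by (simp add: inj_image_eq_iff)
      moreover have "s = s'"
      proof (rule PiE_ext[OF s])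
        fix i assume "i \<in> {1..<r}"
        then have i: "0 < i" "i < r"
          by auto
        have "curve i (s i) = curve i (s' i)"
          using pat[OF mem(1) s(1) i] pat[OF mem(2) s(2) i] eq by auto
        then show "s i = s' i"
          using inj_curve[OF i(2)] by (auto dest: injD)
      qed
      ultimately show "x = y"
        by (simp add: eqs)
    qed
    have "card (?\<S> \<times> ?F) = (N choose k) * N ^ (r - 1)"
      using T n_subsets[OF T(1), of k] by (simp add: card_cartesian_product card_PiE)
    moreover have "card (f ` (?\<S> \<times> ?F)) = card (?\<S> \<times> ?F)"
      by (rule card_image[OF inj_on_imageI2[OF inj]])
    moreover have "card (f ` (?\<S> \<times> ?F)) \<le> complexity (\<Sum>i<r. convex hull (?V i))"
      by (rule complexity_sum_ge[OF _ _ inj_on_imageI[OF inj]]) (use finV T(3) in \<open>auto simp: verts_def\<close>)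
    ultimately show ?thesis
      by simp
  qed
  ultimately show ?thesis
    by blast
qed

end

section \<open>Asymptotic comparison of the two bounds\<close>

lemma max_sum_complexity_ge:
  assumes "0 < k" "0 < r" "2 * k + r - 1 \<le> DIM('a::euclidean_space)" "0 < N"
  shows "(N choose k) * N ^ (r - 1) \<le> max_sum_complexity TYPE('a) r (N + DIM('a))"
proof -
  obtain \<beta> :: "nat \<Rightarrow> 'a" where "bij_betw \<beta> {..<DIM('a)} Basis"
    using ex_bij_betw_nat_finite[OF finite_Basis] by (auto simp: atLeast0LessThan)
  then interpret ordered_basis \<beta> k r
    using assms by unfold_locales auto
  obtain V where V: "\<And>i. i < r \<Longrightarrow> convex hull (V i) \<in> n_vertex_polytopes DIM('a) (N + DIM('a))"
    and le: "(N choose k) * N ^ (r - 1) \<le> complexity (\<Sum>i<r. convex hull (V i) :: 'a set)"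
    using sum_complexity_ge[OF assms(4)] by blast
  have "complexity (\<Sum>i<r. convex hull (V i)) \<in> sum_complexities TYPE('a) r (N + DIM('a))"
    unfolding sum_complexities_def using V by (intro CollectI exI[of _ "\<lambda>i. convex hull (V i)"]) auto
  then have "complexity (\<Sum>i<r. convex hull (V i)) \<le> max_sum_complexity TYPE('a) r (N + DIM('a))"
    unfolding max_sum_complexity_def by (intro Max_ge finite_sum_complexities)
  then show ?thesis
    using le by linarith
qed

theorem mainTheorem2:
  fixes d r :: nat
  assumes "CARD('d::finite) = d" and "3 \<le> d" and "2 \<le> r" and "r \<le> d - 1"
  shows "(\<lambda>n. real (max_sum_complexity TYPE(real ^ 'd) r n))
           \<in> \<Theta>(\<lambda>n. real n ^ ((d + r - 1) div 2))"
proof -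
  let ?m = "max_sum_complexity TYPE(real ^ 'd) r"
  define D where "D = d + r - 1"
  define K where "K = D div 2"
  define k where "k = K - r + 1"
  have dim: "DIM(real ^ 'd) = d"
    using assms(1) by simp
  \<comment> \<open>From \<open>r \<le> d - 1\<close> follows \<open>2 * r \<le> D\<close>, hence
    \<open>k > 0\<close>. The construction fits because
    \<open>2 * k + r - 1 = 2 * K - r + 1 \<le> d\<close>, and it yields the exponent
    \<open>k + (r - 1) = K\<close>.\<close>
  have K: "r \<le> K" "2 * K \<le> d + r - 1"
    using assms by (auto simp: K_def D_def)
  have k: "0 < k" "2 * k + r - 1 \<le> d" "k + (r - 1) = K"
    using K assms(3) by (auto simp: k_def)
  define C where "C = 2 * d * (2 ^ Suc D * Suc (D div 2)) * r ^ K"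
  have "\<forall>\<^sub>F n in sequentially. norm (real (?m n)) \<le> real (2 + C) * norm (real n ^ K)"
    using eventually_gt_at_top[of d]
  proof eventually_elim
    case (elim n)
    have "?m n \<le> 2 + 2 * d * (2 ^ Suc D * Suc (D div 2) * (r * n) ^ (D div 2))"
      using max_sum_complexity_le[where 'a = "real ^ 'd", of n r D] elim assms dim by (simp add: D_def)
    also have "\<dots> = 2 + C * n ^ K"
      by (simp add: C_def K_def power_mult_distrib mult_ac)
    also have "\<dots> \<le> (2 + C) * n ^ K"
    proof -
      have "1 \<le> n ^ K"
        using elim by simp
      then show ?thesis
        by (simp add: algebra_simps)
    qed
    finally have "real (?m n) \<le> real ((2 + C) * n ^ K)"
      by (simp only: of_nat_le_iff)
    then show ?case
      by (simp add: algebra_simps)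
  qed
  then have "(\<lambda>n. real (?m n)) \<in> O(\<lambda>n. real n ^ K)"
    by (rule bigoI)
  \<comment> \<open>The construction spends \<open>d\<close> of the \<open>n\<close> vertices on the
    apex simplex. From \<open>n \<ge> 2 * d + k\<close> on, \<open>N = n - d\<close> is at least
    \<open>n / 2\<close>, giving \<open>2 ^ K\<close>, and at least \<open>k\<close>; the factor
    \<open>real k ^ k\<close> comes from bounding the binomial below by
    \<open>(N / k) ^ k\<close>.\<close>
  moreover have "\<forall>\<^sub>F n in sequentially. norm (real n ^ K) \<le> (2 ^ K * real k ^ k) * norm (real (?m n))"
    using eventually_ge_at_top[of "2 * d + k"]
  proof eventually_elim
    case (elim n)
    define N where "N = n - d"
    have N: "n = N + d" "k \<le> N" "0 < N" "n \<le> 2 * N"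
      using elim k(1) assms(2) by (auto simp: N_def)
    have "(real N / real k) ^ k * real N ^ (r - 1) \<le> real (N choose k) * real N ^ (r - 1)"
      using binomial_ge_n_over_k_pow_k[OF N(2), where 'a = real] by (intro mult_right_mono) auto
    also have "\<dots> = real ((N choose k) * N ^ (r - 1))"
      by simp
    also have "\<dots> \<le> real (?m n)"
    proof -
      have "(N choose k) * N ^ (r - 1) \<le> ?m n"
        using max_sum_complexity_ge[where 'a = "real ^ 'd", of k r N] k N assms(3) dim by simp
      then show ?thesis
        by (simp only: of_nat_le_iff)
    qed
    finally have le: "(real N / real k) ^ k * real N ^ (r - 1) \<le> real (?m n)" .
    have "real n ^ K \<le> (2 * real N) ^ K"
      using N(4) by (intro power_mono) auto
    also have "\<dots> = 2 ^ K * (real N ^ k * real N ^ (r - 1))"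
      by (simp add: power_mult_distrib flip: k(3) power_add)
    also have "\<dots> = (2 ^ K * real k ^ k) * ((real N / real k) ^ k * real N ^ (r - 1))"
      using k(1) by (simp add: power_divide)
    also have "\<dots> \<le> (2 ^ K * real k ^ k) * real (?m n)"
      using le by (intro mult_left_mono) auto
    finally show ?case
      by simp
  qed
  then have "(\<lambda>n. real n ^ K) \<in> O(\<lambda>n. real (?m n))"
    by (rule bigoI)
  ultimately show ?thesis
    by (simp add: bigtheta_def bigomega_iff_bigo K_def D_def)
qed

end
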